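(* Let $f\in L^1([-\pi,\pi]^d)$ with $f=\mathrm{Re}(f)+\mathbf{i}\,\mathrm{Im}(f)$, where $\mathrm{Re}(f)$ and $\mathrm{Im}(f)$ are real-valued and $\mathrm{Re}(f)$ is essentially positive, and suppose that the multilevel Toeplitz matrix $T_n[f]$ generated by $f$ is real, $T_n[f]\in\mathbb{R}^{n\times n}$. Let $\mathcal{H}([f])=(T_n[f]+T_n[f]^{\top})/2$. Then the MINRES method with preconditioner $\mathcal{H}([f])$ applied to the symmetrized system $Y_nT_n[f]\mathbf{u}=Y_n\mathbf{b}$ has a convergence rate independent of $\mathbf{n}=(n_1,\dots,n_d)$: there is a constant $\epsilon$, independent of $\mathbf{n}$, with $$\epsilon<\operatorname*{ess\,sup}_{\boldsymbol{\theta}\in[-\pi,\pi]^d}\left|\frac{\mathrm{Im}(f)(\boldsymbol{\theta})}{\mathrm{Re}(f)(\boldsymbol{\theta})}\right|,$$ such that the residuals generated by the MINRES method satisfy $$\frac{\|\mathbf{r}^{(k)}\|_2}{\|\mathbf{r}^{(0)}\|_2}\le 2\,\omega^{[k]},\qquad \omega:=\sqrt{\frac{\epsilon}{2+\epsilon}}\in(0,1),$$ where $\omega$ is independent of $\mathbf{n}$, $\mathbf{r}^{(k)}=\mathcal{H}([f])^{-1}Y_n\mathbf{b}-\mathcal{H}([f])^{-1}Y_nT_n[f]\,\tilde{\mathbf{u}}_*^{(k)}$, $\tilde{\mathbf{u}}_*^{(k)}$ denotes the $k$-th iterate of MINRES, and $\tilde{\mathbf{u}}_*^{(0)}$ is an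 arbitrary initial guess.
   Context: Functions $f\in L^1([-\pi,\pi]^d)$ are complex-valued, Lebesgue integrable and periodically extended to $\mathbb{R}^d$. For $\mathbf{n}=(n_1,\dots,n_d)$ with positive integer entries, $n=n_1n_2\cdots n_d$, the multilevel Toeplitz matrix generated by $f$ is $T_n[f]=\sum_{|j_1|<n_1}\cdots\sum_{|j_d|<n_d}J_{n_1}^{j_1}\otimes\cdots\otimes J_{n_d}^{j_d}\,a_{(j_1,\dots,j_d)}$, where $a_{(\mathbf{j})}=\frac{1}{(2\pi)^d}\int_{[-\pi,\pi]^d}f(\boldsymbol{\theta})e^{\mathbf{i}\langle\mathbf{j},\boldsymbol{\theta}\rangle}\,d\boldsymbol{\theta}$, $\mathbf{i}^2=-1$, and $J_m^j$ is the $m\times m$ matrix whose $(l,h)$ entry is $1$ if $l-h=j$ and $0$ otherwise. $\otimes$ is the Kronecker product. $Y_m$ is the $m\times m$ anti-identity matrix ($[Y_m]_{j,k}=1$ iff $j+k=m+1$, else $0$) and $Y_n=Y_{n_1}\otimes\cdots\otimes Y_{n_d}$; the matrix $Y_nT_n[f]$ is symmetric when $T_n[f]$ is real. "Essentially positive" means positive almost everywhere. $\mathbf{b}\in\mathbb{R}^n$ is the right-hand side vector. MINRES is the standard (preconditioned) minimal residual method for symmetric systems with a symmetric positive definite preconditioner. $[\cdot]$ denotes the integer part.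
   Formalization: As printed the claim is false; the residuals are measured in the H([f])-norm instead of the Euclidean norm, the exponent [k] is replaced by 2[k/2], and ess sup |Im(f)/Re(f)| is assumed to be positive and finite. *)

theory Defs
  imports
    "HOL-Analysis.Analysis"
    "HOL-Probability.Essential_Supremum"
    "Jordan_Normal_Form.Gauss_Jordan_Elimination"
    "Jordan_Normal_Form.VS_Connect"
begin

text \<open>
  The index type \<open>'d\<close> of \<open>real ^ 'd\<close> plays the role of \<open>{1, ..., d}\<close>; its linear order fixes the order
  of the factors in the d-fold Kronecker products. The level sizes are a function
  \<open>n :: 'd \<Rightarrow> nat\<close>, so that matrices of all sizes can be quantified over for one fixed symbol.
\<close>

definition torus_box :: "(real ^ 'd::finite) set" where
  "torus_box = cbox (\<chi> i. - pi) (\<chi> i. pi)"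

definition fourier_coeff :: "(real ^ 'd::finite \<Rightarrow> complex) \<Rightarrow> ('d \<Rightarrow> int) \<Rightarrow> complex" where
  "fourier_coeff f j = 1 / of_real ((2 * pi) ^ CARD('d)) *
     integral\<^sup>L (lebesgue_on torus_box)
       (\<lambda>\<theta>. f \<theta> * exp (\<i> * of_real (\<Sum>i\<in>UNIV. of_int (j i) * vec_nth \<theta> i)))"

definition kron :: "'a::semiring_1 mat \<Rightarrow> 'a mat \<Rightarrow> 'a mat" where
  "kron A B = mat (dim_row A * dim_row B) (dim_col A * dim_col B)
     (\<lambda>(l, h). A $$ (l div dim_row B, h div dim_col B) * B $$ (l mod dim_row B, h mod dim_col B))"

definition kron_family :: "('d::{finite,linorder} \<Rightarrow> 'a::semiring_1 mat) \<Rightarrow> 'a mat" where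
  "kron_family A = foldr kron (map A (sorted_list_of_set UNIV)) (1\<^sub>m 1)"

definition shift_mat :: "nat \<Rightarrow> int \<Rightarrow> 'a::semiring_1 mat" where
  "shift_mat m j = mat m m (\<lambda>(l, h). if int l - int h = j then 1 else 0)"

text \<open>Rows and columns are numbered from 0, so the condition \<open>j + k = m + 1\<close> becomes \<open>j + k + 1 = m\<close>.\<close>

definition anti_identity :: "nat \<Rightarrow> 'a::semiring_1 mat" where
  "anti_identity m = mat m m (\<lambda>(j, k). if j + k + 1 = m then 1 else 0)"

definition multilevel_anti_identity :: "('d::{finite,linorder} \<Rightarrow> nat) \<Rightarrow> 'a::semiring_1 mat" where
  "multilevel_anti_identity n = kron_family (\<lambda>i. anti_identity (n i))"

definition multilevel_toeplitz ::
    "('d::{finite,linorder} \<Rightarrow> nat) \<Rightarrow> (real ^ 'd::{finite,linorder} \<Rightarrow> complex) \<Rightarrow> complex mat" where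
  "multilevel_toeplitz n f = mat (\<Prod>i\<in>UNIV. n i) (\<Prod>i\<in>UNIV. n i)
     (\<lambda>(l, h). \<Sum>j\<in>{j. \<forall>i. \<bar>j i\<bar> < int (n i)}.
        kron_family (\<lambda>i. shift_mat (n i) (j i)) $$ (l, h) * fourier_coeff f j)"

text \<open>The same matrix with real entries; meaningful only if all entries of
  \<open>multilevel_toeplitz n f\<close> are real.\<close>

definition real_toeplitz ::
    "('d::{finite,linorder} \<Rightarrow> nat) \<Rightarrow> (real ^ 'd::{finite,linorder} \<Rightarrow> complex) \<Rightarrow> real mat" where
  "real_toeplitz n f = map_mat Re (multilevel_toeplitz n f)"

definition sym_part :: "real mat \<Rightarrow> real mat" where
  "sym_part A = (1 / 2) \<cdot>\<^sub>m (A + transpose_mat A)"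

definition inv_mat :: "real mat \<Rightarrow> real mat" where
  "inv_mat A = the (mat_inverse A)"

definition precond_residual :: "real mat \<Rightarrow> real mat \<Rightarrow> real Matrix.vec \<Rightarrow> real Matrix.vec \<Rightarrow> real Matrix.vec" where
  "precond_residual P A b u = inv_mat P *\<^sub>v b - inv_mat P *\<^sub>v (A *\<^sub>v u)"

text \<open>
  MINRES with a symmetric positive definite preconditioner P is MINRES for the symmetric matrix
  P^(-1/2) A P^(-1/2). The Euclidean norm of the residual of that system is the P-norm of the
  preconditioned residual \<open>P\<^sup>-\<^sup>1 (b - A u)\<close>, equivalently the \<open>P\<^sup>-\<^sup>1\<close>-norm of \<open>b - A u\<close>. This is the
  quantity which the method minimizes; the Euclidean norm of the preconditioned residual
  itself is not controlled by the spectrum of \<open>P\<^sup>-\<^sup>1 A\<close> alone.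
\<close>

definition energy_norm :: "real mat \<Rightarrow> real Matrix.vec \<Rightarrow> real" where
  "energy_norm P v = sqrt (scalar_prod v (P *\<^sub>v v))"

definition krylov_space :: "real mat \<Rightarrow> real Matrix.vec \<Rightarrow> nat \<Rightarrow> real Matrix.vec set" where
  "krylov_space B v k =
     LinearCombinations.module.span class_ring (module_vec TYPE(real) (dim_vec v))
       ((\<lambda>i. (B ^\<^sub>m i) *\<^sub>v v) ` {..<k})"

definition minres_search_space ::
    "real mat \<Rightarrow> real mat \<Rightarrow> real Matrix.vec \<Rightarrow> real Matrix.vec \<Rightarrow> nat \<Rightarrow> real Matrix.vec set" where
  "minres_search_space P A b u0 k =
     {u0 + z | z. z \<in> krylov_space (inv_mat P * A) (precond_residual P A b u0) k}"

definition minres_iterate ::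
    "real mat \<Rightarrow> real mat \<Rightarrow> real Matrix.vec \<Rightarrow> real Matrix.vec \<Rightarrow> nat \<Rightarrow> real Matrix.vec \<Rightarrow> bool" where
  "minres_iterate P A b u0 k u \<longleftrightarrow>
     u \<in> minres_search_space P A b u0 k \<and>
     (\<forall>w\<in>minres_search_space P A b u0 k.
        energy_norm P (precond_residual P A b u) \<le> energy_norm P (precond_residual P A b w))"

end

theory Submission
  imports Defs
begin

text \<open>
  Write \<open>B = H\<^sup>-\<^sup>1 Y T\<close> and split \<open>T = H + S\<close> with \<open>S\<close> skew. Since \<open>Y\<close> is an involution commuting with
  \<open>H\<close>, the energy norms satisfy \<open>|B x|\<^sup>2 = |x|\<^sup>2 + |H\<^sup>-\<^sup>1 S x|\<^sup>2\<close>. Writing both quadratic forms as integrals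
  of \<open>f\<close> against trigonometric polynomials and applying AM-GM under the integral gives
  \<open>|H\<^sup>-\<^sup>1 S x| \<le> m |x|\<close>, where \<open>m\<close> is the essential supremum. Hence \<open>1 \<le> B\<^sup>2 \<le> 1 + m\<^sup>2\<close> as quadratic
  forms, and \<open>\<epsilon> = \<surd>(1 + m\<^sup>2) - 1 < m\<close> works: the Chebyshev polynomial of degree \<open>k div 2\<close> in \<open>B\<^sup>2\<close>,
  scaled to the interval \<open>[1, (1 + \<epsilon>)\<^sup>2]\<close>, is a competitor in the Krylov space. Its norm is estimated
  without the spectral theorem, through a quadratic invariant of the three-term recurrence.
\<close>

section \<open>Krylov spaces\<close>

lemma krylov_space_carrier:
  assumes "B \<in> carrier_mat N N" "r \<in> carrier_vec N"
  shows "krylov_space B r k \<subseteq> carrier_vec N"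
proof -
  interpret vec_space "TYPE(real)" N .
  have "(\<lambda>i. (B ^\<^sub>m i) *\<^sub>v r) ` {..<k} \<subseteq> carrier_vec N"
    using assms by (auto intro!: mult_mat_vec_carrier pow_carrier_mat)
  then show ?thesis
    using assms span_closed by (auto simp: krylov_space_def)
qed

lemma krylov_space_closed:
  assumes "B \<in> carrier_mat N N" "r \<in> carrier_vec N"
  shows krylov_space_zero: "0\<^sub>v N \<in> krylov_space B r k"
    and krylov_space_add: "\<And>x y. \<lbrakk>x \<in> krylov_space B r k; y \<in> krylov_space B r k\<rbrakk> \<Longrightarrow> x + y \<in> krylov_space B r k"
    and krylov_space_smult: "\<And>c x. x \<in> krylov_space B r k \<Longrightarrow> c \<cdot>\<^sub>v x \<in> krylov_space B r k"
proof -
  interpret vec_space "TYPE(real)" N .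
  have S: "(\<lambda>i. (B ^\<^sub>m i) *\<^sub>v r) ` {..<k} \<subseteq> carrier_vec N"
    using assms by (auto intro!: mult_mat_vec_carrier pow_carrier_mat)
  have d: "dim_vec r = N" using assms by auto
  show "0\<^sub>v N \<in> krylov_space B r k"
    using span_zero unfolding krylov_space_def d by (simp add: module_vec_simps)
  show "\<And>x y. \<lbrakk>x \<in> krylov_space B r k; y \<in> krylov_space B r k\<rbrakk> \<Longrightarrow> x + y \<in> krylov_space B r k"
    using span_add1 S unfolding krylov_space_def d by (simp add: module_vec_simps)
  show "\<And>c x. x \<in> krylov_space B r k \<Longrightarrow> c \<cdot>\<^sub>v x \<in> krylov_space B r k"
    using smult_in_span S unfolding krylov_space_def d by (simp add: module_vec_simps)
qed

lemma krylov_space_generator: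
  assumes "B \<in> carrier_mat N N" "r \<in> carrier_vec N" "i < k"
  shows "(B ^\<^sub>m i) *\<^sub>v r \<in> krylov_space B r k"
proof -
  interpret vec_space "TYPE(real)" N .
  have S: "(\<lambda>i. (B ^\<^sub>m i) *\<^sub>v r) ` {..<k} \<subseteq> carrier_vec N"
    using assms by (auto intro!: mult_mat_vec_carrier pow_carrier_mat)
  have d: "dim_vec r = N" using assms by auto
  show ?thesis
    using in_own_span[of "(\<lambda>i. (B ^\<^sub>m i) *\<^sub>v r) ` {..<k}"] S assms(3) unfolding krylov_space_def d
    by (auto simp: subset_iff)
qed

lemma krylov_space_mono:
  assumes "B \<in> carrier_mat N N" "r \<in> carrier_vec N" "k \<le> l"
  shows "krylov_space B r k \<subseteq> krylov_space B r l"
proof -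
  interpret vec_space "TYPE(real)" N .
  have d: "dim_vec r = N" using assms by auto
  show ?thesis
    unfolding krylov_space_def d using assms(3) by (intro span_is_monotone image_mono) auto
qed

text \<open>\<open>pow_mat\<close> appends the new factor on the right. With \<open>r\<close>
  arbitrary, the induction moves that factor to the left, where the Krylov recursion needs
  it.\<close>

lemma pow_mat_mult_vec_Suc:
  fixes B :: "'a::comm_ring_1 mat"
  assumes "B \<in> carrier_mat N N" "r \<in> carrier_vec N"
  shows "(B ^\<^sub>m Suc i) *\<^sub>v r = B *\<^sub>v ((B ^\<^sub>m i) *\<^sub>v r)"
  using assms(2)
proof (induction i arbitrary: r)
  case 0
  then show ?case using assms(1) by simp
next
  case (Suc i)
  have "(B ^\<^sub>m Suc (Suc i)) *\<^sub>v r = (B ^\<^sub>m Suc i) *\<^sub>v (B *\<^sub>v r)"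
    using assms(1) Suc.prems by (metis assoc_mult_mat_vec pow_carrier_mat pow_mat.simps(2))
  also have "\<dots> = B *\<^sub>v ((B ^\<^sub>m i) *\<^sub>v (B *\<^sub>v r))"
    using Suc assms(1) by simp
  also have "(B ^\<^sub>m i) *\<^sub>v (B *\<^sub>v r) = (B ^\<^sub>m Suc i) *\<^sub>v r"
    using assms(1) Suc.prems by (metis assoc_mult_mat_vec pow_carrier_mat pow_mat.simps(2))
  finally show ?case .
qed

text \<open>The preimage of the next Krylov space under \<open>B\<close> is a submodule and contains
  every generator of the current one, hence also their span.\<close>

lemma krylov_space_mult:
  assumes B: "B \<in> carrier_mat N N" and r: "r \<in> carrier_vec N" and z: "z \<in> krylov_space B r k"
  shows "B *\<^sub>v z \<in> krylov_space B r (Suc k)"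
proof -
  interpret vec_space "TYPE(real)" N .
  have d: "dim_vec r = N" using r by auto
  let ?P = "{x \<in> carrier_vec N. B *\<^sub>v x \<in> krylov_space B r (Suc k)}"
  have "submodule class_ring ?P V"
  proof (unfold_locales, goal_cases)
    case 1 then show ?case by (auto simp: module_vec_simps)
  next
    case (2 v w)
    then show ?case
      using krylov_space_add[OF B r] B by (auto simp: module_vec_simps mult_add_distrib_mat_vec)
  next
    case 3
    have "B *\<^sub>v 0\<^sub>v N = 0\<^sub>v N" using B by (intro eq_vecI) auto
    then show ?case
      using krylov_space_zero[OF B r] by (auto simp: module_vec_simps)
  next
    case (4 c v)
    then show ?case
      using krylov_space_smult[OF B r] B by (auto simp: module_vec_simps mult_mat_vec)
  qed
  moreover have "(\<lambda>i. (B ^\<^sub>m i) *\<^sub>v r) ` {..<k} \<subseteq> ?P"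
    using B r krylov_space_generator[OF B r, of "Suc _"] pow_mat_mult_vec_Suc[OF B r]
    by (auto intro!: mult_mat_vec_carrier pow_carrier_mat)
  ultimately have "span ((\<lambda>i. (B ^\<^sub>m i) *\<^sub>v r) ` {..<k}) \<subseteq> ?P"
    using span_is_subset by blast
  then show ?thesis using z unfolding krylov_space_def d by auto
qed

text \<open>The vectors \<open>p(B) r\<close> with a polynomial \<open>p\<close> of degree at most \<open>k\<close> and \<open>p(0) = c\<close>.\<close>

definition polynomial_vectors :: "real mat \<Rightarrow> real Matrix.vec \<Rightarrow> nat \<Rightarrow> real \<Rightarrow> real Matrix.vec set" where
  "polynomial_vectors B r k c = {c \<cdot>\<^sub>v r - B *\<^sub>v z | z. z \<in> krylov_space B r k}"

context
  fixes B :: "real mat" and r :: "real Matrix.vec" and N :: nat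
  assumes B: "B \<in> carrier_mat N N" and r: "r \<in> carrier_vec N"
begin

lemma polynomial_vectorE:
  assumes "x \<in> polynomial_vectors B r k c"
  obtains z where "z \<in> krylov_space B r k" "z \<in> carrier_vec N" "x = c \<cdot>\<^sub>v r - B *\<^sub>v z"
  using assms krylov_space_carrier[OF B r] unfolding polynomial_vectors_def by blast

lemma polynomial_vectorI: "z \<in> krylov_space B r k \<Longrightarrow> x = c \<cdot>\<^sub>v r - B *\<^sub>v z \<Longrightarrow> x \<in> polynomial_vectors B r k c"
  unfolding polynomial_vectors_def by blast

lemma polynomial_vector_start: "r \<in> polynomial_vectors B r k 1"
  by (rule polynomial_vectorI[OF krylov_space_zero[OF B r]]) (use B r in auto)

lemma polynomial_vector_mono: "x \<in> polynomial_vectors B r k c \<Longrightarrow> k \<le> l \<Longrightarrow> x \<in> polynomial_vectors B r l c"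
  using krylov_space_mono[OF B r] unfolding polynomial_vectors_def by blast

lemma polynomial_vector_smult:
  assumes "x \<in> polynomial_vectors B r k c"
  shows "a \<cdot>\<^sub>v x \<in> polynomial_vectors B r k (a * c)"
proof -
  obtain z where z: "z \<in> krylov_space B r k" "z \<in> carrier_vec N" "x = c \<cdot>\<^sub>v r - B *\<^sub>v z"
    using polynomial_vectorE[OF assms] .
  have "a \<cdot>\<^sub>v x = (a * c) \<cdot>\<^sub>v r - B *\<^sub>v (a \<cdot>\<^sub>v z)"
    unfolding z(3) mult_mat_vec[OF B z(2)] using B r z(2)
    by (intro eq_vecI) (auto simp: algebra_simps)
  with krylov_space_smult[OF B r z(1)] show ?thesis by (rule polynomial_vectorI)
qed

lemma polynomial_vector_diff:
  assumes "x \<in> polynomial_vectors B r k c" "y \<in> polynomial_vectors B r k d"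
  shows "x - y \<in> polynomial_vectors B r k (c - d)"
proof -
  obtain z where z: "z \<in> krylov_space B r k" "z \<in> carrier_vec N" "x = c \<cdot>\<^sub>v r - B *\<^sub>v z"
    using polynomial_vectorE[OF assms(1)] .
  obtain w where w: "w \<in> krylov_space B r k" "w \<in> carrier_vec N" "y = d \<cdot>\<^sub>v r - B *\<^sub>v w"
    using polynomial_vectorE[OF assms(2)] .
  have "B *\<^sub>v (z + (-1) \<cdot>\<^sub>v w) = B *\<^sub>v z + (-1) \<cdot>\<^sub>v (B *\<^sub>v w)"
    using B z w by (simp add: mult_add_distrib_mat_vec mult_mat_vec)
  then have "x - y = (c - d) \<cdot>\<^sub>v r - B *\<^sub>v (z + (-1) \<cdot>\<^sub>v w)"
    unfolding z(3) w(3) using B r z(2) w(2) by (intro eq_vecI) (auto simp: algebra_simps)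
  then show ?thesis
    by (rule polynomial_vectorI[rotated]) (intro krylov_space_add[OF B r] krylov_space_smult[OF B r] z w)
qed

text \<open>Multiplication by \<open>B\<close> raises the degree by one and kills the constant term.
  The witness is \<open>- x\<close> itself, which lies in the next Krylov space.\<close>

lemma polynomial_vector_mult:
  assumes "x \<in> polynomial_vectors B r k c"
  shows "B *\<^sub>v x \<in> polynomial_vectors B r (Suc k) 0"
proof -
  obtain z where z: "z \<in> krylov_space B r k" "z \<in> carrier_vec N" "x = c \<cdot>\<^sub>v r - B *\<^sub>v z"
    using polynomial_vectorE[OF assms] .
  have "r \<in> krylov_space B r (Suc k)"
    using krylov_space_generator[OF B r, of 0 "Suc k"] B r by simp
  then have "(- c) \<cdot>\<^sub>v r + B *\<^sub>v z \<in> krylov_space B r (Suc k)"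
    by (intro krylov_space_add[OF B r] krylov_space_smult[OF B r] krylov_space_mult[OF B r] z)
  moreover have "B *\<^sub>v x = 0 \<cdot>\<^sub>v r - B *\<^sub>v ((- c) \<cdot>\<^sub>v r + B *\<^sub>v z)"
  proof -
    have "(- c) \<cdot>\<^sub>v r + B *\<^sub>v z = (-1) \<cdot>\<^sub>v x"
      unfolding z(3) using B r z(2) by (intro eq_vecI) (auto simp: algebra_simps)
    moreover have "x \<in> carrier_vec N" unfolding z(3) using B r z(2) by auto
    ultimately show ?thesis
      using B r by (intro eq_vecI) (auto simp: mult_mat_vec)
  qed
  ultimately show ?thesis by (rule polynomial_vectorI)
qed

end

section \<open>Chebyshev polynomials of a self-adjoint contraction\<close>

locale energy_space =
  fixes N :: nat and H :: "real mat"
  assumes H: "H \<in> carrier_mat N N" and H_sym: "transpose_mat H = H"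
    and H_pos: "\<And>x. x \<in> carrier_vec N \<Longrightarrow> x \<noteq> 0\<^sub>v N \<Longrightarrow> 0 < scalar_prod x (H *\<^sub>v x)"
begin

text \<open>The inner product behind the energy norm: \<open>energy_norm H v\<close> is
  \<open>sqrt (ip v v)\<close>.\<close>

definition ip :: "real Matrix.vec \<Rightarrow> real Matrix.vec \<Rightarrow> real" where
  "ip x y = scalar_prod x (H *\<^sub>v y)"

lemma
  assumes "x \<in> carrier_vec N" "y \<in> carrier_vec N" "z \<in> carrier_vec N"
  shows ip_add_left: "ip (x + y) z = ip x z + ip y z"
    and ip_diff_left: "ip (x - y) z = ip x z - ip y z"
    and ip_add_right: "ip z (x + y) = ip z x + ip z y"
    and ip_diff_right: "ip z (x - y) = ip z x - ip z y"
  using assms H unfolding ip_def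
  by (auto simp: mult_add_distrib_mat_vec mult_minus_distrib_mat_vec add_scalar_prod_distrib[of _ N]
    scalar_prod_add_distrib[of _ N] minus_scalar_prod_distrib[of _ N] scalar_prod_minus_distrib[of _ N])

lemma
  assumes "x \<in> carrier_vec N" "y \<in> carrier_vec N"
  shows ip_smult_left: "ip (c \<cdot>\<^sub>v x) y = c * ip x y"
    and ip_smult_right: "ip x (c \<cdot>\<^sub>v y) = c * ip x y"
  using assms H unfolding ip_def by (auto simp: mult_mat_vec)

lemma ip_commute:
  assumes "x \<in> carrier_vec N" "y \<in> carrier_vec N"
  shows "ip x y = ip y x"
  unfolding ip_def using transpose_vec_mult_scalar[OF H assms(2,1)] H assms
  by (simp add: H_sym comm_scalar_prod[of _ N])

lemma ip_nonneg: "x \<in> carrier_vec N \<Longrightarrow> 0 \<le> ip x x"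
  using H_pos[of x] H unfolding ip_def by (cases "x = 0\<^sub>v N") auto

lemmas ip_simps = ip_add_left ip_diff_left ip_add_right ip_diff_right ip_smult_left ip_smult_right

text \<open>Positive definiteness excludes a kernel vector, so the determinant is nonzero and
  \<open>mat_inverse\<close> returns \<open>Some\<close>; only then does the \<open>the\<close> in
  \<open>inv_mat\<close> denote an inverse.\<close>

lemma inv_mat_inverse:
  shows inv_mat_carrier: "inv_mat H \<in> carrier_mat N N"
    and mult_inv_mat: "H * inv_mat H = 1\<^sub>m N"
proof -
  have "det H \<noteq> 0"
  proof
    assume "det H = 0"
    then obtain v where "v \<in> carrier_vec N" "v \<noteq> 0\<^sub>v N" "H *\<^sub>v v = 0\<^sub>v N"
      using det_0_iff_vec_prod_zero_field[OF H] by auto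
    then show False using H_pos[of v] by simp
  qed
  then have "H \<in> Units (ring_mat TYPE(real) N ())"
    by (rule det_non_zero_imp_unit[OF H])
  then obtain G where "mat_inverse H = Some G"
    using mat_inverse(1)[OF H, where b = "()"] by (cases "mat_inverse H") auto
  then show "inv_mat H \<in> carrier_mat N N" "H * inv_mat H = 1\<^sub>m N"
    using mat_inverse(2)[OF H] by (auto simp: inv_mat_def)
qed

end

text \<open>\<open>C_form\<close> says that -1 \<le> C \<le> 1 as quadratic forms; the norm version
  is derived from it. The intended instance is the affine function of \<open>B\<^sup>2\<close> that
  carries its spectral interval to [-1, 1].\<close>

locale self_adjoint_contraction = energy_space +
  fixes C :: "real Matrix.vec \<Rightarrow> real Matrix.vec"
  assumes C_closed: "x \<in> carrier_vec N \<Longrightarrow> C x \<in> carrier_vec N"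
    and C_diff: "x \<in> carrier_vec N \<Longrightarrow> y \<in> carrier_vec N \<Longrightarrow> C (x - y) = C x - C y"
    and C_smult: "x \<in> carrier_vec N \<Longrightarrow> C (a \<cdot>\<^sub>v x) = a \<cdot>\<^sub>v C x"
    and C_self_adjoint: "x \<in> carrier_vec N \<Longrightarrow> y \<in> carrier_vec N \<Longrightarrow> ip (C x) y = ip x (C y)"
    and C_form: "x \<in> carrier_vec N \<Longrightarrow> \<bar>ip (C x) x\<bar> \<le> ip x x"
begin

text \<open>Uses \<open>2 (1 - C\<^sup>2) = (1 - C)\<^sup>2 (1 + C) + (1 + C)\<^sup>2 (1 - C)\<close>.\<close>

lemma C_contraction:
  assumes x: "x \<in> carrier_vec N"
  shows "ip (C x) (C x) \<le> ip x x"
proof -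
  have [simp]: "C x \<in> carrier_vec N" "C (C x) \<in> carrier_vec N" using x C_closed by auto
  have "x + C x = x - (-1) \<cdot>\<^sub>v C x" using x by (intro eq_vecI) auto
  then have C1: "C (x + C x) = C x - (-1) \<cdot>\<^sub>v C (C x)"
    using x by (simp add: C_diff C_smult)
  have C2: "C (x - C x) = C x - C (C x)"
    using x by (simp add: C_diff)
  have a: "ip (C (C x)) (C x) = ip (C x) (C (C x))" "ip (C (C x)) x = ip (C x) (C x)"
    "ip (C x) x = ip x (C x)"
    using x by (simp_all add: C_self_adjoint)
  \<comment> \<open>The upper estimate at \<open>x + C x\<close> and the lower estimate at
    \<open>x - C x\<close> say that the two summands of the identity are nonnegative. In their sum
    the terms of odd degree in C cancel.\<close>
  have "\<bar>ip (C (x + C x)) (x + C x)\<bar> \<le> ip (x + C x) (x + C x)"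
    "\<bar>ip (C (x - C x)) (x - C x)\<bar> \<le> ip (x - C x) (x - C x)"
    using x by (auto intro!: C_form)
  then show ?thesis
    unfolding C1 C2 using x a by (simp add: ip_simps)
qed

text \<open>Up to a shift of the index, the Chebyshev polynomials of the second kind in \<open>C\<close>,
  applied to \<open>r\<close>.\<close>

fun cheb_U :: "real Matrix.vec \<Rightarrow> nat \<Rightarrow> real Matrix.vec" where
  "cheb_U r 0 = 0\<^sub>v N"
| "cheb_U r (Suc 0) = r"
| "cheb_U r (Suc (Suc m)) = 2 \<cdot>\<^sub>v C (cheb_U r (Suc m)) - cheb_U r m"

fun cheb_T :: "real Matrix.vec \<Rightarrow> nat \<Rightarrow> real Matrix.vec" where
  "cheb_T r 0 = r"
| "cheb_T r (Suc 0) = C r"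
| "cheb_T r (Suc (Suc m)) = 2 \<cdot>\<^sub>v C (cheb_T r (Suc m)) - cheb_T r m"

lemma cheb_U_closed: "r \<in> carrier_vec N \<Longrightarrow> cheb_U r m \<in> carrier_vec N"
  by (induction r m rule: cheb_U.induct) (auto intro!: C_closed minus_carrier_vec smult_carrier_vec)

lemma C_zero: "C (0\<^sub>v N) = 0\<^sub>v N"
proof -
  have "C (0 \<cdot>\<^sub>v 0\<^sub>v N) = 0 \<cdot>\<^sub>v C (0\<^sub>v N)" by (rule C_smult) simp
  also have "0 \<cdot>\<^sub>v C (0\<^sub>v N) = 0\<^sub>v N" using C_closed[of "0\<^sub>v N"] by (intro eq_vecI) auto
  also have "0 \<cdot>\<^sub>v 0\<^sub>v N = (0\<^sub>v N :: real Matrix.vec)" by (intro eq_vecI) auto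
  finally show ?thesis .
qed

text \<open>The classical relation T_m = U_m - x U_(m-1) in the shifted indexing. It reduces norm
  estimates for \<open>cheb_T\<close> to the quadratic invariant of \<open>cheb_U\<close>.\<close>

lemma cheb_T_eq:
  assumes r: "r \<in> carrier_vec N"
  shows "cheb_T r m = cheb_U r (Suc m) - C (cheb_U r m)"
  using r
proof (induction r m rule: cheb_T.induct)
  case (1 r)
  then show ?case by (simp add: C_zero)
next
  case (2 r)
  then have "C r \<in> carrier_vec N" by (rule C_closed)
  then show ?case by (intro eq_vecI) auto
next
  case (3 r m)
  let ?a = "cheb_U r m" and ?b = "cheb_U r (Suc m)"
  have c: "?a \<in> carrier_vec N" "?b \<in> carrier_vec N"
    using cheb_U_closed[OF 3(3)] by blast+
  note c = c C_closed[OF c(1)] C_closed[OF c(2)] C_closed[OF C_closed[OF c(2)]] C_closed[OF C_closed[OF c(1)]]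
  from 3 have T: "cheb_T r m = ?b - C ?a" "cheb_T r (Suc m) = (2 \<cdot>\<^sub>v C ?b - ?a) - C ?b"
    by simp_all
  show ?case
    unfolding cheb_T.simps(3) cheb_U.simps(3) T
    using c by (intro eq_vecI) (auto simp: C_diff C_smult)
qed

text \<open>The operator form of the Pell identity \<open>T\<^sub>m\<^sup>2 + (1 - C\<^sup>2) U\<^sub>m\<^sub>-\<^sub>1\<^sup>2 = 1\<close>.\<close>

lemma cheb_U_invariant:
  assumes r: "r \<in> carrier_vec N"
  shows "ip (cheb_U r (Suc m)) (cheb_U r (Suc m)) - 2 * ip (C (cheb_U r (Suc m))) (cheb_U r m)
    + ip (cheb_U r m) (cheb_U r m) = ip r r"
proof (induction m)
  case 0
  have "ip x (0\<^sub>v N) = 0" if "x \<in> carrier_vec N" for x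
    using ip_diff_right[OF r r that] r by simp
  then show ?case using r C_closed[OF r] by simp
next
  case (Suc m)
  let ?a = "cheb_U r m" and ?b = "cheb_U r (Suc m)"
  have c: "?a \<in> carrier_vec N" "?b \<in> carrier_vec N"
    using cheb_U_closed[OF r] by blast+
  note c = c C_closed[OF c(1)] C_closed[OF c(2)] C_closed[OF C_closed[OF c(2)]] C_closed[OF C_closed[OF c(1)]]
  \<comment> \<open>With these identities the terms 4 \<open>ip (C ?b) (C ?b)\<close> cancel, and
    the quadratic form at the pair (2 C b - a, b) collapses to its value at (b, a).\<close>
  have "ip (C (C ?b)) ?b = ip (C ?b) (C ?b)" "ip (C ?a) ?b = ip (C ?b) ?a" "ip ?a (C ?b) = ip (C ?b) ?a"
    using c C_self_adjoint ip_commute by metis+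
  then show ?case
    using Suc c by (simp add: C_diff C_smult ip_simps)
qed

text \<open>The operator counterpart of |T_m| \<le> 1 on [-1, 1]. By the invariant the defect is
  \<open>ip a a - ip (C a) (C a)\<close> with a = \<open>cheb_U r m\<close>, which is nonnegative
  because C is a contraction.\<close>

lemma cheb_T_le:
  assumes r: "r \<in> carrier_vec N"
  shows "ip (cheb_T r m) (cheb_T r m) \<le> ip r r"
proof -
  let ?a = "cheb_U r m" and ?b = "cheb_U r (Suc m)"
  have c: "?a \<in> carrier_vec N" "?b \<in> carrier_vec N"
    using cheb_U_closed[OF r] by blast+
  note c = c C_closed[OF c(1)] C_closed[OF c(2)]
  have "ip ?b (C ?a) = ip (C ?b) ?a" "ip (C ?a) ?b = ip (C ?b) ?a"
    using c C_self_adjoint ip_commute by metis+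
  then have "ip (cheb_T r m) (cheb_T r m) = ip r r - (ip ?a ?a - ip (C ?a) (C ?a))"
    using cheb_U_invariant[OF r, of m] c by (simp add: cheb_T_eq[OF r] ip_simps)
  then show ?thesis using C_contraction[OF c(1)] by simp
qed

end

section \<open>Scalar Chebyshev values and the MINRES estimate\<close>

text \<open>The scalar shadow of \<open>cheb_T\<close>, used to track constant terms. The bracketing
  in the recurrence matches a scaling by 2 after one application of C.\<close>

fun cheb_val :: "real \<Rightarrow> nat \<Rightarrow> real" where
  "cheb_val x 0 = 1"
| "cheb_val x (Suc 0) = x"
| "cheb_val x (Suc (Suc m)) = 2 * (x * cheb_val x (Suc m)) - cheb_val x m"

text \<open>The Joukowski parametrization: at this argument the characteristic roots of the
  recurrence are -\<rho> and -1/\<rho>. The sign reflects the parity of the Chebyshev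
  polynomials.\<close>

lemma cheb_val_eq:
  assumes "\<rho> \<noteq> 0"
  shows "cheb_val (- ((\<rho> + 1 / \<rho>) / 2)) m = (- 1) ^ m * (\<rho> ^ m + (1 / \<rho>) ^ m) / 2"
proof -
  define \<sigma> where "\<sigma> = 1 / \<rho>"
  have inv: "\<rho> * (\<sigma> * t) = t" for t unfolding \<sigma>_def using assms by simp
  have "cheb_val (- ((\<rho> + \<sigma>) / 2)) m = (- 1) ^ m * (\<rho> ^ m + \<sigma> ^ m) / 2"
  proof (induction "- ((\<rho> + \<sigma>) / 2)" m rule: cheb_val.induct)
    case (3 m)
    have "(\<rho> + \<sigma>) * (\<rho> ^ Suc m + \<sigma> ^ Suc m) = \<rho> ^ Suc (Suc m) + \<sigma> ^ Suc (Suc m) + (\<rho> ^ m + \<sigma> ^ m)"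
      by (simp add: algebra_simps inv)
    moreover have "2 * (- (p / 2) * (- e * x / 2)) - e * y / 2 = e * (p * x - y) / 2" for p e x y :: real
      by (simp add: field_simps)
    ultimately show ?case
      unfolding cheb_val.simps 3 by simp
  next
    case 2
    show ?case unfolding cheb_val.simps power_Suc power_0 by argo
  qed simp
  then show ?thesis unfolding \<sigma>_def .
qed

context energy_space
begin

text \<open>\<open>inv_mat H * A\<close> may be indefinite, with spectrum on both sides of 0, but
  its square lies in [1, a^2]. A Chebyshev polynomial in the square, normalized to the value 1 at 0,
  gives a competitor for the minimization.\<close>

lemma minres_bound:
  assumes A: "A \<in> carrier_mat N N" and A_sym: "transpose_mat A = A"
    and a: "1 < a"
    and low: "\<And>x. x \<in> carrier_vec N \<Longrightarrow> ip x x \<le> ip ((inv_mat H * A) *\<^sub>v x) ((inv_mat H * A) *\<^sub>v x)"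
    and up: "\<And>x. x \<in> carrier_vec N \<Longrightarrow>
      ip ((inv_mat H * A) *\<^sub>v x) ((inv_mat H * A) *\<^sub>v x) \<le> a\<^sup>2 * ip x x"
    and b: "b \<in> carrier_vec N" and u0: "u0 \<in> carrier_vec N"
    and u: "minres_iterate H A b u0 k u"
  shows "energy_norm H (precond_residual H A b u) / energy_norm H (precond_residual H A b u0)
    \<le> 2 * ((a - 1) / (a + 1)) ^ (k div 2)"
proof -
  define B where "B = inv_mat H * A"
  define r where "r = precond_residual H A b u0"
  \<comment> \<open>The map t \<mapsto> \<alpha> t - \<beta> sends 1 to -1 and a^2 to 1, while t = 0
    goes to -\<beta>, outside [-1, 1]. The number \<rho> solves \<beta> = (\<rho> + 1/\<rho>)/2.
    Each use of C costs two powers of B, hence the degree \<open>k div 2\<close>.\<close>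
  define \<alpha> where "\<alpha> = 2 / (a\<^sup>2 - 1)"
  define \<beta> where "\<beta> = (a\<^sup>2 + 1) / (a\<^sup>2 - 1)"
  define \<rho> where "\<rho> = (a + 1) / (a - 1)"
  define m where "m = k div 2"
  define C where "C = (\<lambda>x. \<alpha> \<cdot>\<^sub>v (B *\<^sub>v (B *\<^sub>v x)) - \<beta> \<cdot>\<^sub>v x)"
  note Hi = inv_mat_carrier
  have B: "B \<in> carrier_mat N N" unfolding B_def using Hi A by simp
  have r: "r \<in> carrier_vec N" unfolding r_def precond_residual_def using Hi A b u0 by auto
  have a2: "1 < a\<^sup>2" using a by (simp add: one_less_power)
  have HB: "H *\<^sub>v (B *\<^sub>v x) = A *\<^sub>v x" if "x \<in> carrier_vec N" for x
  proof -
    have "H *\<^sub>v (B *\<^sub>v x) = (H * inv_mat H) *\<^sub>v (A *\<^sub>v x)"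
      unfolding B_def using that H Hi A by simp
    also have "\<dots> = A *\<^sub>v x" unfolding mult_inv_mat using that A by simp
    finally show ?thesis .
  qed
  \<comment> \<open>\<open>B\<close> is self-adjoint for the energy inner product because
    \<open>H * B\<close> is the symmetric matrix \<open>A\<close>.\<close>
  have B_self: "ip (B *\<^sub>v x) y = ip x (B *\<^sub>v y)" if x: "x \<in> carrier_vec N" and y: "y \<in> carrier_vec N" for x y
  proof -
    have "ip (B *\<^sub>v x) y = ip y (B *\<^sub>v x)" using x y B by (intro ip_commute) auto
    also have "\<dots> = scalar_prod y (A *\<^sub>v x)" unfolding ip_def HB[OF x] ..
    also have "\<dots> = scalar_prod (A *\<^sub>v y) x"
      using transpose_vec_mult_scalar[OF A x y] unfolding A_sym by simp
    also have "\<dots> = scalar_prod x (A *\<^sub>v y)" using x y A by (intro comm_scalar_prod) auto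
    also have "\<dots> = ip x (B *\<^sub>v y)" unfolding ip_def HB[OF y] ..
    finally show ?thesis .
  qed
  have Bx: "B *\<^sub>v x \<in> carrier_vec N" if "x \<in> carrier_vec N" for x using B that by simp
  interpret self_adjoint_contraction N H C
  proof unfold_locales
    fix x y :: "real Matrix.vec" assume x: "x \<in> carrier_vec N"
    show "C x \<in> carrier_vec N" unfolding C_def using Bx x by simp
    show "C (c \<cdot>\<^sub>v x) = c \<cdot>\<^sub>v C x" for c
      unfolding C_def using x B by (intro eq_vecI) (auto simp: mult_mat_vec[OF B] algebra_simps)
    show "\<bar>ip (C x) x\<bar> \<le> ip x x"
    proof -
      have "ip (C x) x = \<alpha> * ip (B *\<^sub>v x) (B *\<^sub>v x) - \<beta> * ip x x"
        unfolding C_def using x Bx by (simp add: ip_simps B_self)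
      moreover have "\<alpha> * ip (B *\<^sub>v x) (B *\<^sub>v x) \<le> \<alpha> * (a\<^sup>2 * ip x x)"
        using up[OF x] a2 unfolding B_def \<alpha>_def by (intro mult_left_mono) auto
      moreover have "\<alpha> * ip (B *\<^sub>v x) (B *\<^sub>v x) \<ge> \<alpha> * ip x x"
        using low[OF x] a2 unfolding B_def \<alpha>_def by (intro mult_left_mono) auto
      moreover have "\<alpha> * (a\<^sup>2 * ip x x) = (\<beta> + 1) * ip x x" "\<alpha> * ip x x = (\<beta> - 1) * ip x x"
        unfolding \<alpha>_def \<beta>_def using a2 by (simp_all add: field_simps)
      ultimately show ?thesis by (simp add: algebra_simps)
    qed
    assume y: "y \<in> carrier_vec N"
    show "C (x - y) = C x - C y"
      unfolding C_def using x y B Bx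
      by (intro eq_vecI) (auto simp: mult_minus_distrib_mat_vec[OF B] algebra_simps)
    show "ip (C x) y = ip x (C y)"
      unfolding C_def using x y Bx by (simp add: ip_simps B_self)
  qed
  \<comment> \<open>The constant term is multiplied by -\<beta> only, since the summand with two
    factors B has constant term 0.\<close>
  have step_C: "C x \<in> polynomial_vectors B r (Suc (Suc l)) (- \<beta> * c)" if "x \<in> polynomial_vectors B r l c" for x l c
  proof -
    have "\<alpha> \<cdot>\<^sub>v (B *\<^sub>v (B *\<^sub>v x)) \<in> polynomial_vectors B r (Suc (Suc l)) (\<alpha> * 0)"
      by (rule polynomial_vector_smult[OF B r polynomial_vector_mult[OF B r polynomial_vector_mult[OF B r that]]])
    moreover have "\<beta> \<cdot>\<^sub>v x \<in> polynomial_vectors B r (Suc (Suc l)) (\<beta> * c)"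
      by (rule polynomial_vector_mono[OF B r polynomial_vector_smult[OF B r that]]) simp
    ultimately have "C x \<in> polynomial_vectors B r (Suc (Suc l)) (\<alpha> * 0 - \<beta> * c)"
      unfolding C_def by (rule polynomial_vector_diff[OF B r])
    then show ?thesis by simp
  qed
  have mem_T: "cheb_T r j \<in> polynomial_vectors B r (2 * j) (cheb_val (- \<beta>) j)" for j
  proof (induction "- \<beta>" j rule: cheb_val.induct)
    case 1
    then show ?case using polynomial_vector_start[OF B r] by simp
  next
    case 2
    then show ?case using step_C[OF polynomial_vector_start[OF B r]] by (simp add: numeral_2_eq_2)
  next
    case (3 j)
    have "2 \<cdot>\<^sub>v C (cheb_T r (Suc j)) \<in> polynomial_vectors B r (2 * Suc (Suc j)) (2 * (- \<beta> * cheb_val (- \<beta>) (Suc j)))"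
      using polynomial_vector_smult[OF B r step_C[OF 3(1)], of 2] by simp
    moreover have "cheb_T r j \<in> polynomial_vectors B r (2 * Suc (Suc j)) (cheb_val (- \<beta>) j)"
      by (rule polynomial_vector_mono[OF B r 3(2)]) simp
    ultimately show ?case
      unfolding cheb_T.simps cheb_val.simps by (rule polynomial_vector_diff[OF B r])
  qed
  have \<rho>: "1 < \<rho>" unfolding \<rho>_def using a by simp
  have \<beta>_eq: "\<beta> = (\<rho> + 1 / \<rho>) / 2"
    unfolding \<beta>_def \<rho>_def using a a2 by (simp add: field_simps power2_eq_square)
  have \<tau>: "\<bar>cheb_val (- \<beta>) m\<bar> = (\<rho> ^ m + (1 / \<rho>) ^ m) / 2"
    unfolding \<beta>_eq using \<rho> by (subst cheb_val_eq) (simp_all add: abs_mult)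
  define \<tau> where "\<tau> = cheb_val (- \<beta>) m"
  \<comment> \<open>Dropping the decaying power of 1/\<rho> costs at most a factor 2, which is the 2
    in the final bound.\<close>
  have \<tau>_ge: "\<rho> ^ m / 2 \<le> \<bar>\<tau>\<bar>" unfolding \<tau>_def \<tau> using \<rho> by simp
  have \<rho>m: "0 < \<rho> ^ m" using \<rho> by simp
  have \<tau>0: "\<tau> \<noteq> 0" using \<tau>_ge \<rho>m by auto
  \<comment> \<open>Division by \<tau> makes the constant term 1, so the vector becomes r - B z with
    z in the Krylov space: the residual of the admissible point \<open>u0 + z\<close>.\<close>
  have "cheb_T r m \<in> polynomial_vectors B r k \<tau>"
    unfolding \<tau>_def by (rule polynomial_vector_mono[OF B r mem_T]) (simp add: m_def)
  then have "(1 / \<tau>) \<cdot>\<^sub>v cheb_T r m \<in> polynomial_vectors B r k (1 / \<tau> * \<tau>)"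
    by (rule polynomial_vector_smult[OF B r])
  then obtain z where z: "z \<in> krylov_space B r k" "z \<in> carrier_vec N"
    "(1 / \<tau>) \<cdot>\<^sub>v cheb_T r m = (1 / \<tau> * \<tau>) \<cdot>\<^sub>v r - B *\<^sub>v z"
    by (rule polynomial_vectorE[OF B r])
  have "precond_residual H A b (u0 + z) = r - B *\<^sub>v z"
  proof -
    have "inv_mat H *\<^sub>v (A *\<^sub>v (u0 + z)) = inv_mat H *\<^sub>v (A *\<^sub>v u0) + B *\<^sub>v z"
      unfolding B_def using u0 z(2) A Hi
      by (simp add: mult_add_distrib_mat_vec[OF A] mult_add_distrib_mat_vec[OF Hi])
    then show ?thesis
      unfolding r_def precond_residual_def using A Hi B b u0 z(2)
      by (intro eq_vecI) auto
  qed
  also have "\<dots> = (1 / \<tau>) \<cdot>\<^sub>v cheb_T r m"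
    unfolding z(3) using \<tau>0 r by simp
  finally have res: "precond_residual H A b (u0 + z) = (1 / \<tau>) \<cdot>\<^sub>v cheb_T r m" .
  have T: "cheb_T r m \<in> carrier_vec N"
    unfolding cheb_T_eq[OF r] using cheb_U_closed[OF r] C_closed by simp
  have "energy_norm H (precond_residual H A b u) \<le> energy_norm H (precond_residual H A b (u0 + z))"
    using u z(1) unfolding minres_iterate_def minres_search_space_def B_def r_def by blast
  also have "\<dots> = sqrt ((1 / \<tau>)\<^sup>2 * ip (cheb_T r m) (cheb_T r m))"
    unfolding res energy_norm_def ip_def[symmetric] using T by (simp add: ip_simps power2_eq_square)
  also have "\<dots> = 1 / \<bar>\<tau>\<bar> * sqrt (ip (cheb_T r m) (cheb_T r m))"
    by (simp add: real_sqrt_mult)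
  also have "\<dots> \<le> 1 / \<bar>\<tau>\<bar> * sqrt (ip r r)"
    using cheb_T_le[OF r] by (intro mult_left_mono real_sqrt_le_mono) auto
  also have "\<dots> \<le> 1 / (\<rho> ^ m / 2) * sqrt (ip r r)"
    using \<tau>_ge \<rho>m \<tau>0 ip_nonneg[OF r] by (intro mult_right_mono divide_left_mono) auto
  also have "1 / (\<rho> ^ m / 2) = 2 * ((a - 1) / (a + 1)) ^ m"
    unfolding \<rho>_def by (simp add: power_divide)
  finally have "energy_norm H (precond_residual H A b u) \<le> 2 * ((a - 1) / (a + 1)) ^ m * sqrt (ip r r)" .
  moreover have "energy_norm H r = sqrt (ip r r)" unfolding energy_norm_def ip_def ..
  \<comment> \<open>If the initial residual vanishes, the quotient is 0 by the convention for
    division by zero.\<close>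
  ultimately show ?thesis
    unfolding r_def[symmetric] m_def[symmetric] using ip_nonneg[OF r] a
    by (cases "ip r r = 0") (auto simp: pos_divide_le_eq)
qed

end

section \<open>The symmetrized system\<close>

lemma scalar_prod_sym_part:
  assumes T: "T \<in> carrier_mat N N" and x: "x \<in> carrier_vec N" and y: "y \<in> carrier_vec N"
  shows "scalar_prod x (sym_part T *\<^sub>v y) = (scalar_prod x (T *\<^sub>v y) + scalar_prod y (T *\<^sub>v x)) / 2"
proof -
  have "sym_part T *\<^sub>v y = (1 / 2) \<cdot>\<^sub>v (T *\<^sub>v y + transpose_mat T *\<^sub>v y)"
    unfolding sym_part_def using T y
    by (intro eq_vecI) (auto simp: add_scalar_prod_distrib[of _ N])
  moreover have "scalar_prod x (transpose_mat T *\<^sub>v y) = scalar_prod y (T *\<^sub>v x)"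
    using transpose_vec_mult_scalar[OF T x y] T x y by (simp add: comm_scalar_prod[of _ N])
  ultimately show ?thesis
    using T x y by (simp add: scalar_prod_add_distrib[of _ N])
qed

text \<open>With S = (T - T^t)/2, the left side of \<open>skew\<close> is twice the pairing of y
  with S x. The assumption is the AM-GM form of |H^-1 S x| \<le> M |x| and mentions no inverse. It
  yields the interval [1, 1 + M^2] for the square of the preconditioned matrix.\<close>

lemma symmetrized_minres_bound:
  fixes T Y :: "real mat"
  assumes T: "T \<in> carrier_mat N N" and Y: "Y \<in> carrier_mat N N"
    and Y_sym: "transpose_mat Y = Y" and YY: "Y * Y = 1\<^sub>m N"
    and YTY: "Y * T * Y = transpose_mat T"
    and pos: "\<And>x. x \<in> carrier_vec N \<Longrightarrow> x \<noteq> 0\<^sub>v N \<Longrightarrow> 0 < scalar_prod x (T *\<^sub>v x)"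
    and skew: "\<And>x y. x \<in> carrier_vec N \<Longrightarrow> y \<in> carrier_vec N \<Longrightarrow>
      scalar_prod y (T *\<^sub>v x) - scalar_prod x (T *\<^sub>v y)
        \<le> M\<^sup>2 * scalar_prod x (T *\<^sub>v x) + scalar_prod y (T *\<^sub>v y)"
    and M: "0 < M"
    and b: "b \<in> carrier_vec N" and u0: "u0 \<in> carrier_vec N"
    and u: "minres_iterate (sym_part T) (Y * T) b u0 k u"
  shows "energy_norm (sym_part T) (precond_residual (sym_part T) (Y * T) b u)
      / energy_norm (sym_part T) (precond_residual (sym_part T) (Y * T) b u0)
    \<le> 2 * ((sqrt (1 + M\<^sup>2) - 1) / (sqrt (1 + M\<^sup>2) + 1)) ^ (k div 2)"
proof -
  define H where "H = sym_part T"
  have H: "H \<in> carrier_mat N N" unfolding H_def sym_part_def using T by simp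
  have form: "scalar_prod x (H *\<^sub>v x) = scalar_prod x (T *\<^sub>v x)" if "x \<in> carrier_vec N" for x
    unfolding H_def using scalar_prod_sym_part[OF T that that] by simp
  interpret energy_space N H
  proof
    show "transpose_mat H = H"
      unfolding H_def sym_part_def using T by (intro eq_matI) auto
  qed (use H form pos in auto)
  have A: "Y * T \<in> carrier_mat N N" using T Y by simp
  have Y2: "Y *\<^sub>v (Y *\<^sub>v x) = x" if "x \<in> carrier_vec N" for x
    using assoc_mult_mat_vec[OF Y Y that] that unfolding YY by simp
  have Tt: "transpose_mat T *\<^sub>v x = Y *\<^sub>v (T *\<^sub>v (Y *\<^sub>v x))" if "x \<in> carrier_vec N" for x
    unfolding YTY[symmetric] assoc_mult_mat_vec[OF mult_carrier_mat[OF Y T] Y that]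
    using Y that by (intro assoc_mult_mat_vec[OF Y T] mult_mat_vec_carrier)
  have A_sym: "transpose_mat (Y * T) = Y * T"
  proof -
    have "transpose_mat (Y * T) = Y * T * Y * Y"
      using transpose_mult[OF Y T] unfolding Y_sym YTY by simp
    also have "\<dots> = Y * T * (Y * Y)" using T Y by (intro assoc_mult_mat) auto
    finally show ?thesis unfolding YY right_mult_one_mat[OF A] .
  qed
  \<comment> \<open>Conjugation by \<open>Y\<close> exchanges \<open>T\<close> and its transpose, so
    it fixes their mean.\<close>
  have HY: "H *\<^sub>v (Y *\<^sub>v x) = Y *\<^sub>v (H *\<^sub>v x)" if x: "x \<in> carrier_vec N" for x
  proof -
    have Hx: "H *\<^sub>v x = (1 / 2) \<cdot>\<^sub>v (T *\<^sub>v x + transpose_mat T *\<^sub>v x)" if "x \<in> carrier_vec N" for x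
      unfolding H_def sym_part_def using T that
      by (intro eq_vecI) (auto simp: add_scalar_prod_distrib[of _ N])
    have Yx: "Y *\<^sub>v x \<in> carrier_vec N" using Y x by simp
    note c = mult_mat_vec_carrier[OF T Yx] mult_mat_vec_carrier[OF T x]
    have "Y *\<^sub>v (H *\<^sub>v x) = (1 / 2) \<cdot>\<^sub>v (Y *\<^sub>v (T *\<^sub>v x) + T *\<^sub>v (Y *\<^sub>v x))"
      unfolding Hx[OF x] Tt[OF x] using T Y x c Y2[OF c(1)]
      by (simp add: mult_mat_vec[OF Y] mult_add_distrib_mat_vec[OF Y])
    also have "\<dots> = H *\<^sub>v (Y *\<^sub>v x)"
      unfolding Hx[OF Yx] Tt[OF Yx] Y2[OF x]
      using comm_add_vec[OF mult_mat_vec_carrier[OF Y c(2)] c(1)] by simp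
    finally show ?thesis ..
  qed
  have sandwich: "ip x x \<le> ip ((inv_mat H * (Y * T)) *\<^sub>v x) ((inv_mat H * (Y * T)) *\<^sub>v x) \<and>
    ip ((inv_mat H * (Y * T)) *\<^sub>v x) ((inv_mat H * (Y * T)) *\<^sub>v x) \<le> (sqrt (1 + M\<^sup>2))\<^sup>2 * ip x x"
    if x: "x \<in> carrier_vec N" for x
  proof -
    \<comment> \<open>Here v = H^-1 T x, so that y = H^-1 S x with S the skew part of T.\<close>
    define w where "w = (inv_mat H * (Y * T)) *\<^sub>v x"
    define v where "v = Y *\<^sub>v w"
    define y where "y = v - x"
    have w: "w \<in> carrier_vec N" unfolding w_def using inv_mat_carrier A x by simp
    have v: "v \<in> carrier_vec N" unfolding v_def using Y w by simp
    have y: "y \<in> carrier_vec N" unfolding y_def using v x by simp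
    have Tx: "T *\<^sub>v x \<in> carrier_vec N" using T x by simp
    have "H *\<^sub>v w = (H * inv_mat H) *\<^sub>v (Y *\<^sub>v (T *\<^sub>v x))"
      unfolding w_def assoc_mult_mat_vec[OF inv_mat_carrier A x] assoc_mult_mat_vec[OF Y T x]
      using assoc_mult_mat_vec[OF H inv_mat_carrier mult_mat_vec_carrier[OF Y Tx]] by simp
    then have Hw: "H *\<^sub>v w = Y *\<^sub>v (T *\<^sub>v x)"
      unfolding mult_inv_mat using Y Tx by simp
    have Hv: "H *\<^sub>v v = T *\<^sub>v x"
      unfolding v_def HY[OF w] Hw Y2[OF Tx] ..
    \<comment> \<open>\<open>Y\<close> is symmetric and commutes with \<open>H\<close>, so it
      preserves the energy norm.\<close>
    have "ip w w = scalar_prod w (Y *\<^sub>v (T *\<^sub>v x))" unfolding ip_def Hw ..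
    also have "\<dots> = scalar_prod (Y *\<^sub>v w) (T *\<^sub>v x)"
      using transpose_vec_mult_scalar[OF Y Tx w] unfolding Y_sym by simp
    also have "\<dots> = ip v v" unfolding ip_def Hv unfolding v_def ..
    finally have ww: "ip w w = ip v v" .
    \<comment> \<open>The skew part does not contribute to the form at x. Hence x and y are
      orthogonal, and v = x + y satisfies Pythagoras.\<close>
    have xv: "ip x v = ip x x" unfolding ip_def Hv form[OF x] ..
    have yv: "ip y v = scalar_prod y (T *\<^sub>v x)" unfolding ip_def Hv ..
    have yx: "ip y x = (scalar_prod y (T *\<^sub>v x) + scalar_prod x (T *\<^sub>v y)) / 2"
      unfolding ip_def unfolding H_def by (rule scalar_prod_sym_part[OF T y x])
    have "ip v x = ip x x" using xv ip_commute[OF v x] by simp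
    then have vv: "ip v v = ip x x + ip y y"
      unfolding y_def using x v xv by (simp add: ip_simps)
    \<comment> \<open>\<open>skew\<close> is applied to this particular y; half of
      \<open>ip y y\<close> is then absorbed on the left.\<close>
    have "ip y y = ip y v - ip y x" using ip_diff_right[OF v x y] unfolding y_def by simp
    also have "\<dots> \<le> (M\<^sup>2 * ip x x + ip y y) / 2"
      unfolding yv yx using skew[OF x y] unfolding ip_def form[OF x] form[OF y] by argo
    finally have "ip y y \<le> M\<^sup>2 * ip x x" by simp
    then show ?thesis
      unfolding w_def[symmetric] ww vv using ip_nonneg[OF y] by (simp add: algebra_simps)
  qed
  have "1 < sqrt (1 + M\<^sup>2)" using M by simp
  from minres_bound[OF A A_sym this _ _ b u0 u[folded H_def]] sandwich
  show ?thesis unfolding H_def by blast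
qed

section \<open>Mixed radix digits and Kronecker products\<close>

text \<open>The head of the list is the most significant position, as in \<open>foldr kron\<close>.\<close>

fun mdigit :: "('a \<Rightarrow> nat) \<Rightarrow> 'a list \<Rightarrow> nat \<Rightarrow> 'a \<Rightarrow> nat" where
  "mdigit n [] l i = 0"
| "mdigit n (x # xs) l i = (if i = x then l div prod_list (map n xs)
     else mdigit n xs (l mod prod_list (map n xs)) i)"

fun mweight :: "('a \<Rightarrow> nat) \<Rightarrow> 'a list \<Rightarrow> 'a \<Rightarrow> nat" where
  "mweight n [] i = 0"
| "mweight n (x # xs) i = (if i = x then prod_list (map n xs) else mweight n xs i)"

lemma prod_list_pos: "(\<And>x. x \<in> set xs \<Longrightarrow> 0 < n x) \<Longrightarrow> 0 < prod_list (map n xs)"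
  for n :: "'a \<Rightarrow> nat"
  by (induction xs) auto

lemma mdigit_less:
  assumes "\<And>x. x \<in> set xs \<Longrightarrow> 0 < n x" "l < prod_list (map n xs)" "i \<in> set xs"
  shows "mdigit n xs l i < n i"
  using assms
proof (induction xs arbitrary: l)
  case (Cons x xs)
  have "0 < prod_list (map n xs)" using Cons.prems by (intro prod_list_pos) auto
  then show ?case using Cons by (auto simp: less_mult_imp_div_less)
qed simp

text \<open>A crude bound on place values; it later keeps a curve in the direction of the weights
  inside the torus box.\<close>

lemma mweight_le:
  assumes "\<And>x. x \<in> set xs \<Longrightarrow> 0 < n x"
  shows "mweight n xs i \<le> prod_list (map n xs)"
  using assms
proof (induction xs)
  case (Cons x xs)
  have P: "prod_list (map n xs) \<le> n x * prod_list (map n xs)"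
    using Cons.prems[of x] by (simp add: Suc_leI)
  have "mweight n xs i \<le> prod_list (map n xs)" using Cons by simp
  from this P have "mweight n xs i \<le> n x * prod_list (map n xs)" by (rule order_trans)
  then show ?case using P by (cases "i = x") auto
qed simp

lemma sum_mdigit_mweight:
  assumes "distinct xs" "\<And>x. x \<in> set xs \<Longrightarrow> 0 < n x" "l < prod_list (map n xs)"
  shows "(\<Sum>i\<in>set xs. mdigit n xs l i * mweight n xs i) = l"
  using assms
proof (induction xs arbitrary: l)
  case (Cons x xs)
  let ?P = "prod_list (map n xs)"
  have P: "0 < ?P" using Cons.prems by (intro prod_list_pos) auto
  have "(\<Sum>i\<in>set xs. mdigit n (x # xs) l i * mweight n (x # xs) i)
      = (\<Sum>i\<in>set xs. mdigit n xs (l mod ?P) i * mweight n xs i)"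
    using Cons.prems by (intro sum.cong) auto
  also have "\<dots> = l mod ?P" using Cons P by simp
  finally show ?case using Cons.prems by simp
qed simp

text \<open>Subtracting a number from the largest representable one needs no borrow, so the
  complement acts on each digit separately.\<close>

lemma mdigit_reverse:
  assumes "distinct xs" "\<And>x. x \<in> set xs \<Longrightarrow> 0 < n x" "l + h + 1 = prod_list (map n xs)" "i \<in> set xs"
  shows "mdigit n xs l i + mdigit n xs h i + 1 = n i"
  using assms
proof (induction xs arbitrary: l h)
  case (Cons x xs)
  let ?P = "prod_list (map n xs)"
  have P: "0 < ?P" using Cons.prems by (intro prod_list_pos) auto
  define q r where "q = l div ?P" and "r = l mod ?P"
  have r: "r < ?P" unfolding r_def using P by simp
  have l: "l = q * ?P + r" unfolding q_def r_def by simp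
  have "l < n x * ?P" using Cons.prems by simp
  then have q: "q < n x" unfolding q_def by (simp add: less_mult_imp_div_less)
  \<comment> \<open>The numbers s and t complement the leading digit and the remainder. The additive
    form avoids truncated subtraction.\<close>
  then obtain s where s: "n x = q + 1 + s" using le_Suc_ex[of "q + 1" "n x"] by auto
  obtain t where t: "?P = r + 1 + t" using r le_Suc_ex[of "r + 1" ?P] by auto
  have "h = t + s * ?P"
    using Cons.prems(3) l s t by (simp add: algebra_simps)
  moreover have "t < ?P" using t by simp
  moreover have "(t + s * p) div p = s" "(t + s * p) mod p = t" if "t < p" for p
    using that by simp_all
  ultimately have h: "h div ?P = s" "h mod ?P = t" by blast+
  show ?case
  proof (cases "i = x")
    case True
    then show ?thesis using h s by (simp add: q_def)
  next
    case False
    have "mdigit n xs r i + mdigit n xs t i + 1 = n i"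
      using Cons.prems False t by (intro Cons.IH) auto
    then show ?thesis using False h(2) unfolding r_def by simp
  qed
qed simp

lemma kron_carrier:
  "A \<in> carrier_mat a a' \<Longrightarrow> B \<in> carrier_mat b b' \<Longrightarrow> kron A B \<in> carrier_mat (a * b) (a' * b')"
  unfolding kron_def carrier_mat_def by simp

lemma kron_index:
  assumes "A \<in> carrier_mat a a'" "B \<in> carrier_mat b b'" "l < a * b" "h < a' * b'"
  shows "kron A B $$ (l, h) = A $$ (l div b, h div b') * B $$ (l mod b, h mod b')"
  using assms unfolding kron_def carrier_mat_def by simp

lemma kron_list_carrier:
  assumes "\<And>x. x \<in> set xs \<Longrightarrow> A x \<in> carrier_mat (n x) (n x)"
  shows "foldr kron (map A xs) (1\<^sub>m 1) \<in> carrier_mat (prod_list (map n xs)) (prod_list (map n xs))"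
  using assms
proof (induction xs)
  case (Cons x xs)
  then show ?case using kron_carrier[of "A x" "n x" "n x"] by simp
qed simp

text \<open>Peeling off one Kronecker factor splits an index into quotient and remainder, which is
  the recursion of \<open>mdigit\<close>.\<close>

lemma kron_list_index:
  assumes "distinct xs" "\<And>x. x \<in> set xs \<Longrightarrow> A x \<in> carrier_mat (n x) (n x)" "\<And>x. x \<in> set xs \<Longrightarrow> 0 < n x"
    "l < prod_list (map n xs)" "h < prod_list (map n xs)"
  shows "foldr kron (map A xs) (1\<^sub>m 1) $$ (l, h) = (\<Prod>i\<in>set xs. A i $$ (mdigit n xs l i, mdigit n xs h i))"
  using assms
proof (induction xs arbitrary: l h)
  case Nil
  then show ?case by simp
next
  case (Cons x xs)
  define P where "P = prod_list (map n xs)"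
  define K where "K = foldr kron (map A xs) (1\<^sub>m 1)"
  have P: "0 < P" unfolding P_def using Cons.prems(3) by (intro prod_list_pos) auto
  have K: "K \<in> carrier_mat P P" unfolding K_def P_def using Cons.prems(2) by (intro kron_list_carrier) auto
  have Ax: "A x \<in> carrier_mat (n x) (n x)" using Cons.prems(2) by simp
  have lh: "l < n x * P" "h < n x * P" using Cons.prems(4,5) unfolding P_def by simp_all
  have "foldr kron (map A (x # xs)) (1\<^sub>m 1) $$ (l, h) = kron (A x) K $$ (l, h)"
    unfolding K_def by simp
  also have "\<dots> = A x $$ (l div P, h div P) * K $$ (l mod P, h mod P)"
    by (rule kron_index[OF Ax K lh])
  also have "K $$ (l mod P, h mod P)
      = (\<Prod>i\<in>set xs. A i $$ (mdigit n xs (l mod P) i, mdigit n xs (h mod P) i))"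
    unfolding K_def
  proof (rule Cons.IH)
    show "l mod P < prod_list (map n xs)" "h mod P < prod_list (map n xs)"
      using P unfolding P_def by simp_all
  qed (use Cons.prems(1-3) in auto)
  also have "\<dots> = (\<Prod>i\<in>set xs. A i $$ (mdigit n (x # xs) l i, mdigit n (x # xs) h i))"
    using Cons.prems(1) unfolding P_def by (intro prod.cong) auto
  also have "A x $$ (l div P, h div P) = A x $$ (mdigit n (x # xs) l x, mdigit n (x # xs) h x)"
    unfolding P_def by simp
  finally show ?case using Cons.prems(1) by simp
qed

section \<open>Multilevel Toeplitz matrices\<close>

definition level_digit :: "('d::{finite,linorder} \<Rightarrow> nat) \<Rightarrow> nat \<Rightarrow> 'd \<Rightarrow> nat" where
  "level_digit n = mdigit n (sorted_list_of_set UNIV)"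

definition level_weight :: "('d::{finite,linorder} \<Rightarrow> nat) \<Rightarrow> 'd \<Rightarrow> nat" where
  "level_weight n = mweight n (sorted_list_of_set UNIV)"

lemma prod_list_levels: "prod_list (map n (sorted_list_of_set UNIV)) = (\<Prod>i\<in>UNIV. n i)"
  for n :: "'d::{finite,linorder} \<Rightarrow> nat"
  using prod.distinct_set_conv_list[of "sorted_list_of_set (UNIV :: 'd set)" n] by simp

context
  fixes n :: "'d::{finite,linorder} \<Rightarrow> nat" and N :: nat
  assumes n_pos: "\<And>i. 0 < n i" and N_def: "N = (\<Prod>i\<in>UNIV. n i)"
begin

lemma N_eq: "prod_list (map n (sorted_list_of_set UNIV)) = N"
  unfolding prod_list_levels N_def ..

lemma level_digit_less: "l < N \<Longrightarrow> level_digit n l i < n i"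
  unfolding level_digit_def by (rule mdigit_less) (auto simp: N_eq n_pos)

lemma level_weight_le: "level_weight n i \<le> N"
  unfolding level_weight_def N_eq[symmetric] by (rule mweight_le) (rule n_pos)

lemma sum_level_digit_weight: "l < N \<Longrightarrow> (\<Sum>i\<in>UNIV. level_digit n l i * level_weight n i) = l"
  using sum_mdigit_mweight[of "sorted_list_of_set UNIV" n l]
  unfolding level_digit_def level_weight_def N_eq by (simp add: n_pos)

lemma level_digit_reverse: "l + h + 1 = N \<Longrightarrow> level_digit n l i + level_digit n h i + 1 = n i"
  unfolding level_digit_def N_eq[symmetric] by (rule mdigit_reverse) (auto simp: n_pos)

lemma level_digit_inject:
  assumes "l < N" "h < N" "\<And>i. level_digit n l i = level_digit n h i"
  shows "l = h"
proof -
  have "l = (\<Sum>i\<in>UNIV. level_digit n l i * level_weight n i)"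
    by (rule sum_level_digit_weight[OF assms(1), symmetric])
  also have "\<dots> = (\<Sum>i\<in>UNIV. level_digit n h i * level_weight n i)"
    by (simp only: assms(3))
  also have "\<dots> = h" by (rule sum_level_digit_weight[OF assms(2)])
  finally show ?thesis .
qed

lemma kron_family_carrier:
  assumes "\<And>i. A i \<in> carrier_mat (n i) (n i)"
  shows "kron_family A \<in> carrier_mat N N"
  unfolding kron_family_def N_eq[symmetric] using assms by (intro kron_list_carrier)

lemma kron_family_index:
  assumes "\<And>i. A i \<in> carrier_mat (n i) (n i)" "l < N" "h < N"
  shows "kron_family A $$ (l, h) = (\<Prod>i\<in>UNIV. A i $$ (level_digit n l i, level_digit n h i))"
  unfolding kron_family_def level_digit_def
  using kron_list_index[of "sorted_list_of_set UNIV" A n l h] assms n_pos by (simp add: N_eq)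

text \<open>An index pair is complementary exactly when all its digit pairs are, so the product of
  the small flips is one flip of the whole index range.\<close>

lemma multilevel_anti_identity_eq: "multilevel_anti_identity n = (anti_identity N :: 'a::comm_semiring_1 mat)"
proof -
  have c: "(anti_identity (n i) :: 'a mat) \<in> carrier_mat (n i) (n i)" for i
    by (simp add: anti_identity_def)
  have K: "(multilevel_anti_identity n :: 'a mat) \<in> carrier_mat N N"
    unfolding multilevel_anti_identity_def using c by (rule kron_family_carrier)
  show ?thesis
  proof (rule eq_matI)
    fix l h assume "l < dim_row (anti_identity N :: 'a mat)" "h < dim_col (anti_identity N :: 'a mat)"
    then have l: "l < N" and h: "h < N" by (simp_all add: anti_identity_def)
    have iff: "(\<forall>i. level_digit n l i + level_digit n h i + 1 = n i) \<longleftrightarrow> l + h + 1 = N"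
    proof
      assume *: "\<forall>i. level_digit n l i + level_digit n h i + 1 = n i"
      \<comment> \<open>The true complement of l has the same digits as h, and digits determine the
        index.\<close>
      define h' where "h' = N - 1 - l"
      have h': "l + h' + 1 = N" unfolding h'_def using l by simp
      have "level_digit n h i = level_digit n h' i" for i
        using level_digit_reverse[OF h', of i] *[rule_format, of i] by simp
      moreover have "h' < N" using h' by simp
      ultimately have "h = h'" using h by (metis level_digit_inject)
      then show "l + h + 1 = N" using h' by simp
    qed (use level_digit_reverse in blast)
    have "(multilevel_anti_identity n :: 'a mat) $$ (l, h)
        = (\<Prod>i\<in>UNIV. anti_identity (n i) $$ (level_digit n l i, level_digit n h i))"
      unfolding multilevel_anti_identity_def using c l h by (rule kron_family_index)
    also have "\<dots> = (\<Prod>i\<in>UNIV. if level_digit n l i + level_digit n h i + 1 = n i then 1 else 0)"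
      using level_digit_less[OF l] level_digit_less[OF h] by (intro prod.cong) (auto simp: anti_identity_def)
    also have "\<dots> = (if \<forall>i. level_digit n l i + level_digit n h i + 1 = n i then 1 else 0)"
      by (auto intro!: prod_zero)
    also have "\<dots> = anti_identity N $$ (l, h)"
      unfolding iff using l h by (simp add: anti_identity_def)
    finally show "(multilevel_anti_identity n :: 'a mat) $$ (l, h) = anti_identity N $$ (l, h)" .
  qed (use K in \<open>auto simp: anti_identity_def\<close>)
qed

text \<open>The product of the shift entries is nonzero for a single multi-index, the vector of
  digit differences, so the defining sum collapses to one Fourier coefficient.\<close>

lemma multilevel_toeplitz_index:
  assumes l: "l < N" and h: "h < N"
  shows "multilevel_toeplitz n f $$ (l, h)
    = fourier_coeff f (\<lambda>i. int (level_digit n l i) - int (level_digit n h i))"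
proof -
  let ?J = "{j. \<forall>i. \<bar>j i\<bar> < int (n i)}"
  let ?d = "\<lambda>i. int (level_digit n l i) - int (level_digit n h i)"
  have "j \<in> (\<Pi>\<^sub>E i\<in>UNIV. {- int (n i) <..< int (n i)})" if "j \<in> ?J" for j
  proof (rule PiE_I)
    fix i
    have "\<bar>j i\<bar> < int (n i)" using that by blast
    then show "j i \<in> {- int (n i) <..< int (n i)}" by auto
  qed simp
  then have "?J \<subseteq> (\<Pi>\<^sub>E i\<in>UNIV. {- int (n i) <..< int (n i)})" by blast
  then have fin: "finite ?J" by (rule finite_subset) (simp add: finite_PiE)
  have "?d \<in> ?J"
  proof
    show "\<forall>i. \<bar>?d i\<bar> < int (n i)"
    proof
      fix i show "\<bar>?d i\<bar> < int (n i)"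
        using level_digit_less[OF l, of i] level_digit_less[OF h, of i] by arith
    qed
  qed
  have K: "kron_family (\<lambda>i. shift_mat (n i) (j i)) $$ (l, h) = (if j = ?d then 1 else 0 :: complex)" for j
  proof -
    have "kron_family (\<lambda>i. shift_mat (n i) (j i)) $$ (l, h)
      = (\<Prod>i\<in>UNIV. shift_mat (n i) (j i) $$ (level_digit n l i, level_digit n h i) :: complex)"
      using l h by (intro kron_family_index) (auto simp: shift_mat_def)
    also have "\<dots> = (\<Prod>i\<in>UNIV. if ?d i = j i then 1 else 0)"
      using level_digit_less[OF l] level_digit_less[OF h] by (intro prod.cong) (auto simp: shift_mat_def)
    also have "\<dots> = (if \<forall>i. ?d i = j i then 1 else 0)"
      by (auto intro!: prod_zero)
    finally show ?thesis by (auto simp: fun_eq_iff)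
  qed
  have "multilevel_toeplitz n f $$ (l, h)
      = (\<Sum>j\<in>?J. kron_family (\<lambda>i. shift_mat (n i) (j i)) $$ (l, h) * fourier_coeff f j)"
    unfolding multilevel_toeplitz_def using l h by (simp add: N_def)
  also have "\<dots> = (\<Sum>j\<in>?J. if j = ?d then fourier_coeff f j else 0)"
    unfolding K by (intro sum.cong) auto
  also have "\<dots> = fourier_coeff f ?d"
    using fin \<open>?d \<in> ?J\<close> by simp
  finally show ?thesis .
qed

lemma real_toeplitz_carrier: "real_toeplitz n f \<in> carrier_mat N N"
  unfolding real_toeplitz_def multilevel_toeplitz_def N_def by simp

lemma real_toeplitz_index:
  assumes "l < N" "h < N"
  shows "real_toeplitz n f $$ (l, h)
    = Re (fourier_coeff f (\<lambda>i. int (level_digit n l i) - int (level_digit n h i)))"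
proof -
  have "multilevel_toeplitz n f \<in> carrier_mat N N"
    unfolding multilevel_toeplitz_def N_def by simp
  then show ?thesis
    unfolding real_toeplitz_def using assms by (simp add: multilevel_toeplitz_index)
qed

text \<open>Persymmetry: complementing both indices negates every digit difference, just as
  exchanging them does.\<close>

lemma real_toeplitz_reverse:
  assumes "l < N" "h < N"
  shows "real_toeplitz n f $$ (N - 1 - l, N - 1 - h) = real_toeplitz n f $$ (h, l)"
proof -
  have "int (level_digit n (N - 1 - l) i) - int (level_digit n (N - 1 - h) i)
      = int (level_digit n h i) - int (level_digit n l i)" for i
    using level_digit_reverse[of l "N - 1 - l" i] level_digit_reverse[of h "N - 1 - h" i] assms by simp
  then show ?thesis using assms by (simp add: real_toeplitz_index)
qed

end

section \<open>Algebra of the flip matrix\<close>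

lemma anti_identity_mult:
  fixes A :: "'a::comm_ring_1 mat"
  assumes A: "A \<in> carrier_mat N N" and l: "l < N" "h < N"
  shows anti_identity_mult_left: "(anti_identity N * A) $$ (l, h) = A $$ (N - 1 - l, h)"
    and anti_identity_mult_right: "(A * anti_identity N) $$ (l, h) = A $$ (l, N - 1 - h)"
proof -
  have "(anti_identity N * A) $$ (l, h) = (\<Sum>k<N. (if l + k + 1 = N then 1 else 0) * A $$ (k, h))"
    using A l by (auto simp: anti_identity_def scalar_prod_def lessThan_atLeast0)
  also have "\<dots> = (\<Sum>k<N. if k = N - 1 - l then A $$ (k, h) else 0)"
    using l by (intro sum.cong) auto
  finally show "(anti_identity N * A) $$ (l, h) = A $$ (N - 1 - l, h)" using l by simp
  have "(A * anti_identity N) $$ (l, h) = (\<Sum>k<N. A $$ (l, k) * (if k + h + 1 = N then 1 else 0))"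
    using A l by (auto simp: anti_identity_def scalar_prod_def lessThan_atLeast0)
  also have "\<dots> = (\<Sum>k<N. if k = N - 1 - h then A $$ (l, k) else 0)"
    using l by (intro sum.cong) auto
  finally show "(A * anti_identity N) $$ (l, h) = A $$ (l, N - 1 - h)" using l by simp
qed

lemma anti_identity_carrier: "anti_identity N \<in> carrier_mat N N"
  by (simp add: anti_identity_def)

lemma transpose_anti_identity: "transpose_mat (anti_identity N) = anti_identity N"
  by (intro eq_matI) (auto simp: anti_identity_def add.commute)

lemma anti_identity_square: "anti_identity N * anti_identity N = (1\<^sub>m N :: 'a::comm_ring_1 mat)"
proof (rule eq_matI)
  fix l h assume "l < dim_row (1\<^sub>m N :: 'a mat)" "h < dim_col (1\<^sub>m N :: 'a mat)"
  then have "l < N" "h < N" by simp_all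
  then show "(anti_identity N * anti_identity N) $$ (l, h) = (1\<^sub>m N :: 'a mat) $$ (l, h)"
    unfolding anti_identity_mult_left[OF anti_identity_carrier \<open>l < N\<close> \<open>h < N\<close>]
    by (auto simp: anti_identity_def)
qed (auto simp: anti_identity_def)

section \<open>Toeplitz forms as integrals against trigonometric polynomials\<close>

text \<open>Frequencies are digit vectors, so differences of two of them are exactly the Fourier
  indices of the Toeplitz entries.\<close>

definition trig_poly :: "('d::{finite,linorder} \<Rightarrow> nat) \<Rightarrow> real Matrix.vec \<Rightarrow> real ^ 'd::{finite,linorder} \<Rightarrow> complex" where
  "trig_poly n x \<theta> = (\<Sum>l<dim_vec x. of_real (vec_index x l)
     * exp (\<i> * of_real (\<Sum>i\<in>UNIV. real (level_digit n l i) * vec_nth \<theta> i)))"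

lemma continuous_on_trig_poly: "continuous_on S (trig_poly n x)"
  unfolding trig_poly_def by (intro continuous_intros)

lemma integrable_mult_continuous:
  fixes f g :: "real ^ 'd::finite \<Rightarrow> 'b::{real_normed_field,second_countable_topology,banach}"
  assumes f: "integrable (lebesgue_on torus_box) f" and g: "continuous_on UNIV g"
  shows "integrable (lebesgue_on torus_box) (\<lambda>\<theta>. f \<theta> * g \<theta>)"
proof -
  have "compact (g ` torus_box)"
    unfolding torus_box_def using g by (intro compact_continuous_image continuous_on_subset[OF g]) auto
  then obtain K where K: "\<And>\<theta>. \<theta> \<in> torus_box \<Longrightarrow> norm (g \<theta>) \<le> K"
    using compact_imp_bounded bounded_iff by (metis imageI)
  have "g \<in> borel_measurable lebesgue"
    using borel_measurable_continuous_onI[OF g] by (intro measurable_completion) simp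
  then have [measurable]: "g \<in> borel_measurable (lebesgue_on torus_box)"
    by (rule measurable_restrict_space1)
  have [measurable]: "f \<in> borel_measurable (lebesgue_on torus_box)" using f by auto
  have "integrable (lebesgue_on torus_box) (\<lambda>\<theta>. K * norm (f \<theta>))" using f by auto
  then show ?thesis
  proof (rule Bochner_Integration.integrable_bound)
    show "AE \<theta> in lebesgue_on torus_box. norm (f \<theta> * g \<theta>) \<le> norm (K * norm (f \<theta>))"
    proof (rule AE_I2)
      fix \<theta> :: "real ^ 'd" assume "\<theta> \<in> space (lebesgue_on torus_box)"
      then have t: "norm (g \<theta>) \<le> K" by (intro K) (simp add: space_restrict_space)
      then have "norm (f \<theta>) * norm (g \<theta>) \<le> norm (f \<theta>) * K" by (intro mult_left_mono) auto
      moreover have "0 \<le> K" using t norm_ge_zero order_trans by blast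
      ultimately show "norm (f \<theta> * g \<theta>) \<le> norm (K * norm (f \<theta>))"
        by (simp add: norm_mult mult.commute)
    qed
  qed measurable
qed

text \<open>The integrand of the bilinear form of the Toeplitz matrix. The conjugate sits on the
  factor of y because the entry (l, h) carries the frequency of l minus that of h.\<close>

definition torus_form :: "('d::{finite,linorder} \<Rightarrow> nat) \<Rightarrow> (real ^ 'd::{finite,linorder} \<Rightarrow> complex) \<Rightarrow> real Matrix.vec \<Rightarrow> real Matrix.vec \<Rightarrow> real ^ 'd::{finite,linorder} \<Rightarrow> complex" where
  "torus_form n f x y \<theta> = f \<theta> * (trig_poly n x \<theta> * cnj (trig_poly n y \<theta>))"

lemma integrable_torus_form:
  "integrable (lebesgue_on torus_box) f \<Longrightarrow> integrable (lebesgue_on torus_box) (torus_form n f x y)"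
  unfolding torus_form_def
  by (intro integrable_mult_continuous continuous_intros continuous_on_trig_poly)

lemma trig_poly_mult_cnj:
  "trig_poly n x \<theta> * cnj (trig_poly n y \<theta>) = (\<Sum>l<dim_vec x. \<Sum>h<dim_vec y.
    of_real (vec_index x l * vec_index y h) * exp (\<i> * of_real
      (\<Sum>i\<in>UNIV. of_int (int (level_digit n l i) - int (level_digit n h i)) * vec_nth \<theta> i)))"
proof -
  have e: "exp (\<i> * of_real (\<Sum>i\<in>UNIV. of_int (int (level_digit n l i) - int (level_digit n h i)) * vec_nth \<theta> i))
    = exp (\<i> * of_real (\<Sum>i\<in>UNIV. real (level_digit n l i) * vec_nth \<theta> i))
      * cnj (exp (\<i> * of_real (\<Sum>i\<in>UNIV. real (level_digit n h i) * vec_nth \<theta> i)))" for l h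
  proof -
    have "(\<Sum>i\<in>UNIV. of_int (int (level_digit n l i) - int (level_digit n h i)) * vec_nth \<theta> i)
        = (\<Sum>i\<in>UNIV. real (level_digit n l i) * vec_nth \<theta> i) - (\<Sum>i\<in>UNIV. real (level_digit n h i) * vec_nth \<theta> i)"
      by (simp add: left_diff_distrib sum_subtractf)
    then show ?thesis
      by (simp only: exp_cnj exp_add[symmetric]) (simp add: algebra_simps)
  qed
  show ?thesis
    unfolding trig_poly_def e cnj_sum sum_product
    by (intro sum.cong refl) (simp add: algebra_simps)
qed

text \<open>The entries are expanded and the finite sums exchanged with the integral. Real parts may
  be taken at the end because x and y are real.\<close>

lemma real_toeplitz_form:
  fixes n :: "'d::{finite,linorder} \<Rightarrow> nat"
  assumes n_pos: "\<And>i. 0 < n i" and f: "integrable (lebesgue_on torus_box) f"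
    and x: "x \<in> carrier_vec (\<Prod>i\<in>UNIV. n i)" and y: "y \<in> carrier_vec (\<Prod>i\<in>UNIV. n i)"
  shows "scalar_prod x (real_toeplitz n f *\<^sub>v y)
    = 1 / (2 * pi) ^ CARD('d) * (LINT \<theta>|lebesgue_on torus_box. Re (torus_form n f x y \<theta>))"
proof -
  define N where "N = (\<Prod>i\<in>UNIV. n i)"
  note toep = real_toeplitz_carrier[OF n_pos N_def] real_toeplitz_index[OF n_pos N_def]
  define c where "c = 1 / (2 * pi) ^ CARD('d)"
  define E where "E = (\<lambda>l h \<theta>. exp (\<i> * complex_of_real
      (\<Sum>i\<in>UNIV. of_int (int (level_digit n l i) - int (level_digit n h i)) * vec_nth \<theta> i)))"
  have d: "dim_vec x = N" "dim_vec y = N" using x y by (auto simp: N_def)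
  have int: "integrable (lebesgue_on torus_box) (\<lambda>\<theta>. f \<theta> * E l h \<theta>)" for l h
    unfolding E_def by (intro integrable_mult_continuous f continuous_intros)
  have coeff: "fourier_coeff f (\<lambda>i. int (level_digit n l i) - int (level_digit n h i))
    = of_real c * (LINT \<theta>|lebesgue_on torus_box. f \<theta> * E l h \<theta>)" for l h
    unfolding fourier_coeff_def E_def c_def by simp
  have "scalar_prod x (real_toeplitz n f *\<^sub>v y)
      = (\<Sum>l<N. vec_index x l * (\<Sum>h<N. real_toeplitz n f $$ (l, h) * vec_index y h))"
    using toep(1)[of f] d by (simp add: scalar_prod_def lessThan_atLeast0)
  also have "\<dots> = (\<Sum>l<N. \<Sum>h<N. vec_index x l * vec_index y h *
      Re (fourier_coeff f (\<lambda>i. int (level_digit n l i) - int (level_digit n h i))))"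
    by (simp add: sum_distrib_left toep(2) mult_ac)
  also have "\<dots> = c * Re (\<Sum>l<N. \<Sum>h<N. of_real (vec_index x l * vec_index y h) *
      (LINT \<theta>|lebesgue_on torus_box. f \<theta> * E l h \<theta>))"
    unfolding coeff by (simp add: sum_distrib_left mult_ac)
  also have "(\<Sum>l<N. \<Sum>h<N. of_real (vec_index x l * vec_index y h) *
      (LINT \<theta>|lebesgue_on torus_box. f \<theta> * E l h \<theta>))
    = (LINT \<theta>|lebesgue_on torus_box. (\<Sum>l<N. \<Sum>h<N. of_real (vec_index x l * vec_index y h) * (f \<theta> * E l h \<theta>)))"
    using int by simp
  also have "\<dots> = (LINT \<theta>|lebesgue_on torus_box. torus_form n f x y \<theta>)"
    unfolding torus_form_def trig_poly_mult_cnj E_def d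
    by (intro Bochner_Integration.integral_cong refl) (simp add: sum_distrib_left mult_ac)
  also have "Re \<dots> = (LINT \<theta>|lebesgue_on torus_box. Re (torus_form n f x y \<theta>))"
    using integrable_torus_form[OF f] by (rule integral_Re[symmetric])
  finally show ?thesis unfolding c_def .
qed

lemma Re_torus_form_diag: "Re (torus_form n f x x \<theta>) = Re (f \<theta>) * (cmod (trig_poly n x \<theta>))\<^sup>2"
  unfolding torus_form_def complex_norm_square[symmetric] by simp

text \<open>Along the curve \<open>t \<mapsto> (t w\<^sub>i)\<close>, with \<open>w\<close> the weights of the digits, the trigonometric polynomial
  becomes an ordinary polynomial in \<open>exp (\<i> t)\<close> with the same coefficients.\<close>

lemma trig_poly_zero_imp_zero:
  fixes n :: "'d::{finite,linorder} \<Rightarrow> nat"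
  assumes n_pos: "\<And>i. 0 < n i" and x: "x \<in> carrier_vec (\<Prod>i\<in>UNIV. n i)"
    and ae: "AE \<theta> in lebesgue_on torus_box. trig_poly n x \<theta> = 0"
  shows "x = 0\<^sub>v (\<Prod>i\<in>UNIV. n i)"
proof -
  define N where "N = (\<Prod>i\<in>UNIV. n i)"
  have N: "0 < N" unfolding N_def using n_pos by (simp add: prod_pos)
  have d: "dim_vec x = N" using x by (simp add: N_def)
  \<comment> \<open>This set is open and negligible, hence empty: vanishing almost everywhere
    becomes vanishing everywhere on the open box.\<close>
  let ?S = "box (\<chi> i. - pi) (\<chi> i. pi) \<inter> {\<theta>. trig_poly n x \<theta> \<noteq> 0} :: (real ^ 'd::{finite,linorder}) set"
  have "open {\<theta>. trig_poly n x \<theta> \<noteq> 0}"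
    by (intro open_Collect_neq continuous_on_trig_poly continuous_on_const)
  then have "open ?S" by (intro open_Int open_box)
  moreover have "negligible ?S"
  proof -
    have "AE \<theta> in lebesgue. \<theta> \<in> torus_box \<longrightarrow> trig_poly n x \<theta> = 0"
      using ae by (subst (asm) AE_restrict_space_iff) (auto simp: torus_box_def)
    then obtain Z where Z: "Z \<in> null_sets lebesgue" "{\<theta>. \<not> (\<theta> \<in> torus_box \<longrightarrow> trig_poly n x \<theta> = 0)} \<subseteq> Z"
      by (auto simp: eventually_ae_filter)
    moreover have "?S \<subseteq> {\<theta>. \<not> (\<theta> \<in> torus_box \<longrightarrow> trig_poly n x \<theta> = 0)}"
      using box_subset_cbox unfolding torus_box_def by blast
    ultimately show ?thesis by (meson negligible_iff_null_sets negligible_subset subset_trans)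
  qed
  ultimately have S: "?S = {}" using open_not_negligible by blast
  define P where "P = (\<Sum>l<N. monom (complex_of_real (vec_index x l)) l)"
  \<comment> \<open>For t < 1/N every coordinate of the curve stays in [0, 1], well inside the box.
    The digit expansion of l turns the exponential into a power with exponent l.\<close>
  have root: "poly P (exp (\<i> * of_real t)) = 0" if t: "t \<in> {0 <..< 1 / real N}" for t
  proof -
    define \<theta> :: "real ^ 'd::{finite,linorder}" where "\<theta> = (\<chi> i. t * real (level_weight n i))"
    have \<theta>: "0 \<le> vec_nth \<theta> i" "vec_nth \<theta> i \<le> 1" for i
    proof -
      show "0 \<le> vec_nth \<theta> i" unfolding \<theta>_def using t by simp
      have "t * real (level_weight n i) \<le> 1 / real N * real N"
        using t level_weight_le[OF n_pos N_def, of i] by (intro mult_mono) auto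
      then show "vec_nth \<theta> i \<le> 1" unfolding \<theta>_def using N by simp
    qed
    have "- pi < vec_nth \<theta> i \<and> vec_nth \<theta> i < pi" for i
      using \<theta>[of i] pi_gt3 by linarith
    then have "\<theta> \<in> box (\<chi> i. - pi) (\<chi> i. pi)"
      by (simp add: mem_box_cart)
    then have "trig_poly n x \<theta> = 0" using S by blast
    moreover have "exp (\<i> * of_real (\<Sum>i\<in>UNIV. real (level_digit n l i) * vec_nth \<theta> i))
        = exp (\<i> * of_real t) ^ l" if "l < N" for l
    proof -
      have "(\<Sum>i\<in>UNIV. real (level_digit n l i) * vec_nth \<theta> i)
          = t * real (\<Sum>i\<in>UNIV. level_digit n l i * level_weight n i)"
        unfolding \<theta>_def by (simp add: sum_distrib_left mult_ac)
      also have "\<dots> = t * real l" unfolding sum_level_digit_weight[OF n_pos N_def that] ..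
      finally show ?thesis by (simp add: exp_of_nat_mult[symmetric] mult_ac)
    qed
    ultimately show ?thesis
      unfolding trig_poly_def P_def d by (simp add: poly_sum poly_monom)
  qed
  \<comment> \<open>The interval lies in [0, pi], where the cosine alone separates points. The
    polynomial thus has infinitely many roots.\<close>
  have "inj_on (\<lambda>t. exp (\<i> * complex_of_real t)) {0 <..< 1 / real N}"
  proof (rule inj_onI)
    fix s t assume st: "s \<in> {0 <..< 1 / real N}" "t \<in> {0 <..< 1 / real N}"
      and eq: "exp (\<i> * complex_of_real s) = exp (\<i> * complex_of_real t)"
    have "1 / real N \<le> 1" using N by simp
    then have "1 / real N \<le> pi" using pi_gt3 by linarith
    then have "0 \<le> s" "s \<le> pi" "0 \<le> t" "t \<le> pi"
      using st unfolding greaterThanLessThan_iff by linarith+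
    moreover have "cos s = cos t" using arg_cong[OF eq, of Re] by (simp add: Re_exp)
    ultimately show "s = t" by (rule cos_inj_pi)
  qed
  then have "infinite ((\<lambda>t. exp (\<i> * complex_of_real t)) ` {0 <..< 1 / real N})"
    using N by (subst finite_image_iff) (auto simp: infinite_Ioo)
  moreover have "(\<lambda>t. exp (\<i> * complex_of_real t)) ` {0 <..< 1 / real N} \<subseteq> {z. poly P z = 0}"
    using root by blast
  ultimately have "P = 0" using poly_roots_finite finite_subset by blast
  moreover have "coeff P l = of_real (vec_index x l)" if "l < N" for l
    using that unfolding P_def coeff_sum coeff_monom by simp
  ultimately have "vec_index x l = 0" if "l < N" for l
    using that by (metis coeff_0 of_real_eq_0_iff)
  then show ?thesis unfolding N_def[symmetric] using d by (intro eq_vecI) auto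
qed

text \<open>The integrand is Re f times a squared modulus. A vanishing integral would force the
  trigonometric polynomial, and with it x, to be zero.\<close>

lemma real_toeplitz_pos:
  fixes n :: "'d::{finite,linorder} \<Rightarrow> nat"
  assumes n_pos: "\<And>i. 0 < n i" and f: "integrable (lebesgue_on torus_box) f"
    and pos: "AE \<theta> in lebesgue_on torus_box. 0 < Re (f \<theta>)"
    and x: "x \<in> carrier_vec (\<Prod>i\<in>UNIV. n i)" "x \<noteq> 0\<^sub>v (\<Prod>i\<in>UNIV. n i)"
  shows "0 < scalar_prod x (real_toeplitz n f *\<^sub>v x)"
proof -
  let ?M = "lebesgue_on (torus_box :: (real ^ 'd::{finite,linorder}) set)"
  let ?g = "\<lambda>\<theta>. Re (torus_form n f x x \<theta>)"
  have int: "integrable ?M ?g" using integrable_torus_form[OF f] by (rule integrable_Re)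
  have nn: "AE \<theta> in ?M. 0 \<le> ?g \<theta>"
    using pos unfolding Re_torus_form_diag by eventually_elim simp
  have "integral\<^sup>L ?M ?g \<noteq> 0"
  proof
    assume "integral\<^sup>L ?M ?g = 0"
    then have "AE \<theta> in ?M. ?g \<theta> = 0"
      using integral_nonneg_eq_0_iff_AE[OF int nn] by simp
    with pos have "AE \<theta> in ?M. trig_poly n x \<theta> = 0"
      unfolding Re_torus_form_diag by eventually_elim auto
    then show False using trig_poly_zero_imp_zero[OF n_pos x(1)] x(2) by blast
  qed
  moreover have "0 \<le> integral\<^sup>L ?M ?g" using nn by (rule integral_nonneg_AE)
  ultimately show ?thesis
    unfolding real_toeplitz_form[OF n_pos f x(1) x(1)] by simp
qed

text \<open>Re f cancels from the antisymmetric part, leaving Im f, which is at most m Re f in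
  modulus. The pointwise AM-GM inequality 2 (m |p|) |q| \<le> m^2 |p|^2 + |q|^2 is then
  integrated.\<close>

lemma real_toeplitz_skew_bound:
  fixes n :: "'d::{finite,linorder} \<Rightarrow> nat"
  assumes n_pos: "\<And>i. 0 < n i" and f: "integrable (lebesgue_on torus_box) f"
    and pos: "AE \<theta> in lebesgue_on torus_box. 0 < Re (f \<theta>)"
    and bound: "AE \<theta> in lebesgue_on torus_box. \<bar>Im (f \<theta>) / Re (f \<theta>)\<bar> \<le> m"
    and x: "x \<in> carrier_vec (\<Prod>i\<in>UNIV. n i)" and y: "y \<in> carrier_vec (\<Prod>i\<in>UNIV. n i)"
  shows "scalar_prod y (real_toeplitz n f *\<^sub>v x) - scalar_prod x (real_toeplitz n f *\<^sub>v y)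
    \<le> m\<^sup>2 * scalar_prod x (real_toeplitz n f *\<^sub>v x) + scalar_prod y (real_toeplitz n f *\<^sub>v y)"
proof -
  let ?M = "lebesgue_on (torus_box :: (real ^ 'd::{finite,linorder}) set)"
  let ?g = "\<lambda>x y \<theta>. Re (torus_form n f x y \<theta>)"
  have int: "integrable ?M (?g x y)" for x y
    using integrable_torus_form[OF f] by (rule integrable_Re)
  have le: "AE \<theta> in ?M. ?g y x \<theta> - ?g x y \<theta> \<le> m\<^sup>2 * ?g x x \<theta> + ?g y y \<theta>"
    using pos bound
  proof eventually_elim
    case (elim \<theta>)
    define p q where "p = trig_poly n x \<theta>" and "q = trig_poly n y \<theta>"
    have "?g y x \<theta> - ?g x y \<theta> = - 2 * Im (f \<theta>) * Im (q * cnj p)"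
      unfolding torus_form_def p_def[symmetric] q_def[symmetric] by (simp add: algebra_simps)
    also have "\<dots> \<le> \<bar>- 2 * Im (f \<theta>) * Im (q * cnj p)\<bar>" by (rule abs_ge_self)
    also have "\<dots> = 2 * \<bar>Im (f \<theta>)\<bar> * \<bar>Im (q * cnj p)\<bar>" by (simp only: abs_mult abs_minus_cancel abs_numeral)
    also have "\<dots> \<le> 2 * (m * Re (f \<theta>)) * (cmod q * cmod p)"
    proof (intro mult_mono)
      show "\<bar>Im (f \<theta>)\<bar> \<le> m * Re (f \<theta>)"
        using elim by (simp add: abs_divide divide_le_eq)
      then show "0 \<le> 2 * (m * Re (f \<theta>))" by simp
      show "\<bar>Im (q * cnj p)\<bar> \<le> cmod q * cmod p"
        using abs_Im_le_cmod[of "q * cnj p"] by (simp add: norm_mult)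
    qed auto
    also have "\<dots> = Re (f \<theta>) * (2 * (m * cmod p) * cmod q)" by (simp add: mult_ac)
    also have "\<dots> \<le> Re (f \<theta>) * ((m * cmod p)\<^sup>2 + (cmod q)\<^sup>2)"
      using elim sum_squares_bound[of "m * cmod p" "cmod q"] by (intro mult_left_mono) auto
    also have "\<dots> = m\<^sup>2 * ?g x x \<theta> + ?g y y \<theta>"
      unfolding Re_torus_form_diag p_def q_def by (simp add: power_mult_distrib algebra_simps)
    finally show ?case .
  qed
  have "integral\<^sup>L ?M (?g y x) - integral\<^sup>L ?M (?g x y) = (LINT \<theta>|?M. ?g y x \<theta> - ?g x y \<theta>)"
    using int by simp
  also have "\<dots> \<le> (LINT \<theta>|?M. m\<^sup>2 * ?g x x \<theta> + ?g y y \<theta>)"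
    using int le by (intro integral_mono_AE) auto
  also have "\<dots> = m\<^sup>2 * integral\<^sup>L ?M (?g x x) + integral\<^sup>L ?M (?g y y)"
    using int by simp
  finally have *: "integral\<^sup>L ?M (?g y x) - integral\<^sup>L ?M (?g x y)
    \<le> m\<^sup>2 * integral\<^sup>L ?M (?g x x) + integral\<^sup>L ?M (?g y y)" .
  note form = real_toeplitz_form[OF n_pos f]
  show ?thesis
    unfolding form[OF x x] form[OF x y] form[OF y x] form[OF y y]
    using mult_left_mono[OF *, of "1 / (2 * pi) ^ CARD('d)"] by (simp add: algebra_simps)
qed

section \<open>The convergence rate independent of the level sizes\<close>

text \<open>The constants are chosen before the level sizes. The bounds on \<open>M\<close> leave
  room for a positive real \<epsilon> below it. The exponent \<open>2 * (k div 2)\<close> arises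
  because the competitor is a polynomial in the square of the preconditioned matrix.\<close>

theorem corollary1:
  fixes f :: "real ^ 'd::{finite,linorder} \<Rightarrow> complex"
  defines "M \<equiv> esssup (lebesgue_on torus_box) (\<lambda>\<theta>. ereal \<bar>Im (f \<theta>) / Re (f \<theta>)\<bar>)"
  assumes "integrable (lebesgue_on torus_box) f"
    and "AE \<theta> in lebesgue_on torus_box. 0 < Re (f \<theta>)"
    and "0 < M" and "M < \<infinity>"
  shows "\<exists>\<epsilon> \<omega> :: real. ereal \<epsilon> < M \<and> \<omega> = sqrt (\<epsilon> / (2 + \<epsilon>)) \<and> 0 < \<omega> \<and> \<omega> < 1 \<and>
    (\<forall>n :: 'd \<Rightarrow> nat. (\<forall>i. 0 < n i) \<longrightarrow> elements_mat (multilevel_toeplitz n f) \<subseteq> \<real> \<longrightarrow>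
      (let N = (\<Prod>i\<in>UNIV. n i);
           Y = multilevel_anti_identity n;
           T = real_toeplitz n f;
           H = sym_part T
       in \<forall>b \<in> carrier_vec N. \<forall>u0 \<in> carrier_vec N. \<forall>k u.
            minres_iterate H (Y * T) (Y *\<^sub>v b) u0 k u \<longrightarrow>
            energy_norm H (precond_residual H (Y * T) (Y *\<^sub>v b) u)
              / energy_norm H (precond_residual H (Y * T) (Y *\<^sub>v b) u0)
            \<le> 2 * \<omega> ^ (2 * (k div 2))))"
proof -
  obtain m where m: "M = ereal m" "0 < m"
    using \<open>0 < M\<close> \<open>M < \<infinity>\<close> by (cases M) auto
  have bound: "AE \<theta> in lebesgue_on torus_box. \<bar>Im (f \<theta>) / Re (f \<theta>)\<bar> \<le> m"
    using esssup_AE[of "\<lambda>\<theta>. ereal \<bar>Im (f \<theta>) / Re (f \<theta>)\<bar>" "lebesgue_on torus_box"]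
    unfolding M_def[symmetric] m(1) by simp
  \<comment> \<open>Chosen so that 1 + \<epsilon> = a with a^2 = 1 + m^2, the upper end of the
    interval. Then (a - 1)/(a + 1) = \<epsilon>/(2 + \<epsilon>), the square of \<omega>; one factor
    \<omega> accounts for each single step.\<close>
  define \<epsilon> where "\<epsilon> = sqrt (1 + m\<^sup>2) - 1"
  define \<omega> where "\<omega> = sqrt (\<epsilon> / (2 + \<epsilon>))"
  have \<epsilon>: "0 < \<epsilon>" unfolding \<epsilon>_def using m(2) by simp
  have "1 + m\<^sup>2 < (1 + m)\<^sup>2" using m(2) by (simp add: power2_sum)
  then have "sqrt (1 + m\<^sup>2) < 1 + m" using m(2) by (intro real_less_lsqrt) auto
  then have \<epsilon>_less: "ereal \<epsilon> < M" unfolding \<epsilon>_def m(1) by simp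
  have \<omega>: "0 < \<omega>" "\<omega> < 1" unfolding \<omega>_def using \<epsilon> by simp_all
  have rate: "energy_norm H (precond_residual H (Y * T) (Y *\<^sub>v b) u)
      / energy_norm H (precond_residual H (Y * T) (Y *\<^sub>v b) u0) \<le> 2 * \<omega> ^ (2 * (k div 2))"
    if n: "\<forall>i. 0 < n i" and defs: "N = (\<Prod>i\<in>UNIV. n i)" "Y = multilevel_anti_identity n"
      "T = real_toeplitz n f" "H = sym_part T"
      and b: "b \<in> carrier_vec N" and u0: "u0 \<in> carrier_vec N"
      and u: "minres_iterate H (Y * T) (Y *\<^sub>v b) u0 k u"
    for n :: "'d \<Rightarrow> nat" and N Y T H b u0 k u
  proof -
    have n_pos: "\<And>i. 0 < n i" using n by blast
    have Y: "Y = anti_identity N"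
      unfolding defs(2) by (rule multilevel_anti_identity_eq[OF n_pos defs(1)])
    have Yc: "Y \<in> carrier_mat N N" unfolding Y by (rule anti_identity_carrier)
    have T: "T \<in> carrier_mat N N" unfolding defs(3) by (rule real_toeplitz_carrier[OF n_pos defs(1)])
    \<comment> \<open>The flips on both sides complement both indices, so persymmetry applies entry
      by entry.\<close>
    have "Y * T * Y = transpose_mat T"
    proof (rule eq_matI)
      fix l h assume "l < dim_row (transpose_mat T)" "h < dim_col (transpose_mat T)"
      then have l: "l < N" "h < N" using T by simp_all
      have "(Y * T * Y) $$ (l, h) = (Y * T) $$ (l, N - 1 - h)"
        unfolding Y by (rule anti_identity_mult_right[OF mult_carrier_mat[OF anti_identity_carrier T] l])
      also have "\<dots> = T $$ (N - 1 - l, N - 1 - h)"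
        unfolding Y using l by (intro anti_identity_mult_left[OF T]) auto
      also have "\<dots> = T $$ (h, l)"
        unfolding defs(3) by (rule real_toeplitz_reverse[OF n_pos defs(1) l])
      finally show "(Y * T * Y) $$ (l, h) = transpose_mat T $$ (l, h)" using T l by simp
    qed (use T Yc in auto)
    then have "energy_norm H (precond_residual H (Y * T) (Y *\<^sub>v b) u)
          / energy_norm H (precond_residual H (Y * T) (Y *\<^sub>v b) u0)
        \<le> 2 * ((sqrt (1 + m\<^sup>2) - 1) / (sqrt (1 + m\<^sup>2) + 1)) ^ (k div 2)"
      unfolding defs(4)
    proof (intro symmetrized_minres_bound[OF T Yc])
      show "transpose_mat Y = Y" "Y * Y = 1\<^sub>m N"
        unfolding Y by (rule transpose_anti_identity anti_identity_square)+
      show "0 < scalar_prod x (T *\<^sub>v x)" if "x \<in> carrier_vec N" "x \<noteq> 0\<^sub>v N" for x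
        using that unfolding defs(1,3) by (intro real_toeplitz_pos n_pos assms)
      show "scalar_prod y (T *\<^sub>v x) - scalar_prod x (T *\<^sub>v y)
          \<le> m\<^sup>2 * scalar_prod x (T *\<^sub>v x) + scalar_prod y (T *\<^sub>v y)"
        if "x \<in> carrier_vec N" "y \<in> carrier_vec N" for x y
        using that unfolding defs(1,3) by (intro real_toeplitz_skew_bound n_pos assms bound)
      show "minres_iterate (sym_part T) (Y * T) (Y *\<^sub>v b) u0 k u" using u unfolding defs(4) .
    qed (use Yc b u0 m(2) in auto)
    also have "(sqrt (1 + m\<^sup>2) - 1) / (sqrt (1 + m\<^sup>2) + 1) = \<omega>\<^sup>2"
      unfolding \<omega>_def using \<epsilon> by (simp add: \<epsilon>_def add.commute)
    finally show ?thesis by (simp add: power_mult)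
  qed
  show ?thesis
    unfolding Let_def
  proof (intro exI conjI allI impI ballI)
    show "ereal \<epsilon> < M" "0 < \<omega>" "\<omega> < 1" by (fact \<epsilon>_less \<omega>)+
    show "\<omega> = sqrt (\<epsilon> / (2 + \<epsilon>))" by (fact \<omega>_def)
  qed (rule rate[OF _ refl refl refl refl])
qed

end
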